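(* Let $w\in S_n$ be fireworks. Then the support of $\mathfrak{G}_w^{\mathrm{top}}$ is exactly $\{\mathrm{wt}(\overline{D(w)})\}$.
   Context: Permutations act on the right; $s_j$ swaps positions $j,j+1$. With $\partial_j f=\frac{f-s_jf}{x_j-x_{j+1}}$ ($s_jf$ swaps $x_j,x_{j+1}$) and $\overline{\partial}_j f=\partial_j((1-x_{j+1})f)$, the Grothendieck polynomial is defined by $\mathfrak{G}_{w_0}=x_1^{n-1}\cdots x_{n-1}$ for $w_0=n(n-1)\cdots1$ and $\mathfrak{G}_w=\overline{\partial}_j\mathfrak{G}_{ws_j}$ when $w(j)<w(j+1)$. $\mathfrak{G}_w^{\mathrm{top}}$ denotes the highest-degree nonzero homogeneous component of $\mathfrak{G}_w$; the support of a polynomial is the set of exponent vectors with nonzero coefficient. A permutation is fireworks if the initial elements of its decreasing runs (maximal consecutive decreasing segments of the one-line notation) occur in increasing order. The Rothe diagram is $D(w)=\{(i,j)\in[n]^2: i<w^{-1}(j),\ j<w(i)\}$ ($i$ row, $j$ column); the upper closure of a diagram $D$ is $\overline{D}=\{(i,j): i\le i' \text{ for some }(i',j)\in D\}$, and $\mathrm{wt}(D)\in\mathbb{Z}^n$ has $i$-th entry the number of boxes of $D$ in row $i$. *)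

theory Defs
  imports "HOL-Library.Poly_Mapping" "HOL-Combinatorics.Permutations" "HOL-Combinatorics.Transposition"
begin

text \<open>Polynomials in variables x_1, x_2, ... with integer coefficients are represented
  as finitely supported maps from exponent vectors (finitely supported maps nat => nat,
  the value at i being the exponent of x_i) to int.  Multiplication is the convolution
  product of the library, so this is the polynomial ring Z[x_1, x_2, ...].\<close>

type_synonym expvec = "nat \<Rightarrow>\<^sub>0 nat"
type_synonym ipoly = "expvec \<Rightarrow>\<^sub>0 int"

definition var :: "nat \<Rightarrow> ipoly" where
  "var i = Poly_Mapping.single (Poly_Mapping.single i 1) 1"

definition swap_exp :: "nat \<Rightarrow> expvec \<Rightarrow> expvec" where
  "swap_exp j a = Abs_poly_mapping (\<lambda>i. Poly_Mapping.lookup a (transpose j (Suc j) i))"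

definition swapvar :: "nat \<Rightarrow> ipoly \<Rightarrow> ipoly" where
  "swapvar j f = Abs_poly_mapping (\<lambda>a. Poly_Mapping.lookup f (swap_exp j a))"

definition divdiff :: "nat \<Rightarrow> ipoly \<Rightarrow> ipoly" where
  "divdiff j f = (THE g. (var j - var (Suc j)) * g = f - swapvar j f)"

definition bdivdiff :: "nat \<Rightarrow> ipoly \<Rightarrow> ipoly" where
  "bdivdiff j f = divdiff j ((1 - var (Suc j)) * f)"

text \<open>Permutations of [n] = {1..n} as functions nat => nat fixing everything outside.\<close>
definition longest :: "nat \<Rightarrow> nat \<Rightarrow> nat" where
  "longest n i = (if 1 \<le> i \<and> i \<le> n then n + 1 - i else i)"

definition staircase :: "nat \<Rightarrow> ipoly" where
  "staircase n = Poly_Mapping.single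
      (Abs_poly_mapping (\<lambda>i. if 1 \<le> i \<and> i \<le> n then n - i else 0)) 1"

text \<open>The recursive definition of Grothendieck polynomials, as the relation
  "g is obtained for w by the defining recursion".  Right action: w s_j = w o s_j.\<close>
inductive groth_rel :: "nat \<Rightarrow> (nat \<Rightarrow> nat) \<Rightarrow> ipoly \<Rightarrow> bool" for n where
  top: "groth_rel n (longest n) (staircase n)"
| step: "\<lbrakk> groth_rel n (w \<circ> transpose j (Suc j)) g; 1 \<le> j; j < n; w j < w (Suc j) \<rbrakk>
         \<Longrightarrow> groth_rel n w (bdivdiff j g)"

definition groth :: "nat \<Rightarrow> (nat \<Rightarrow> nat) \<Rightarrow> ipoly" where
  "groth n w = (THE g. groth_rel n w g)"

definition tdeg :: "expvec \<Rightarrow> nat" where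
  "tdeg a = (\<Sum>i\<in>Poly_Mapping.keys a. Poly_Mapping.lookup a i)"

definition top_part :: "ipoly \<Rightarrow> ipoly" where
  "top_part f = Abs_poly_mapping
      (\<lambda>a. if tdeg a = Max (tdeg ` Poly_Mapping.keys f) then Poly_Mapping.lookup f a else 0)"

text \<open>Fireworks: initial elements of decreasing runs of w(1)...w(n) increase.
  Position i starts a run iff i = 1 or w(i-1) < w(i).\<close>
definition run_start :: "(nat \<Rightarrow> nat) \<Rightarrow> nat \<Rightarrow> nat \<Rightarrow> bool" where
  "run_start w n i \<longleftrightarrow> 1 \<le> i \<and> i \<le> n \<and> (i = 1 \<or> w (i - 1) < w i)"

definition fireworks :: "nat \<Rightarrow> (nat \<Rightarrow> nat) \<Rightarrow> bool" where
  "fireworks n w \<longleftrightarrow> (\<forall>i i'. run_start w n i \<and> run_start w n i' \<and> i < i' \<longrightarrow> w i < w i')"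

definition rothe :: "nat \<Rightarrow> (nat \<Rightarrow> nat) \<Rightarrow> (nat \<times> nat) set" where
  "rothe n w = {(i, j). i \<in> {1..n} \<and> j \<in> {1..n} \<and> i < inv w j \<and> j < w i}"

definition upper_closure :: "nat \<Rightarrow> (nat \<times> nat) set \<Rightarrow> (nat \<times> nat) set" where
  "upper_closure n D = {(i, j). 1 \<le> i \<and> (\<exists>i'. i \<le> i' \<and> (i', j) \<in> D)}"

definition wt :: "nat \<Rightarrow> (nat \<times> nat) set \<Rightarrow> expvec" where
  "wt n D = Abs_poly_mapping (\<lambda>i. if 1 \<le> i \<and> i \<le> n then card {j. (i, j) \<in> D} else 0)"

end

theory Submission
  imports Defs
begin

text \<open>
  Following Fomin and Kirillov, the Grothendieck polynomials are the coefficients of the product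
  \<open>\<Prod>\<^sub>i (1 + x\<^sub>i u\<^sub>n\<^sub>-\<^sub>1) \<dots> (1 + x\<^sub>i u\<^sub>i)\<close> in the 0-Hecke algebra with \<open>u\<^sub>e\<^sup>2 = - u\<^sub>e\<close>.  This product
  shows that the coefficients alternate in sign with the degree, so nothing cancels.  Reading the
  rows of the product from the left, every monomial of \<open>G\<^sub>w\<close> has its \<open>i\<close>-th exponent bounded by the
  number of positions \<open>p > i\<close> with a larger value in a position of \<open>[i, p)\<close>, which is the weight of
  the upper closure of the Rothe diagram.  For fireworks \<open>w\<close> this bound is the number of descents
  at positions \<open>\<ge> i\<close>, and it is attained by choosing in each row the values
  at the descent bottoms as letters.
\<close>

section \<open>Polynomials and divided differences\<close>

lemma lookup_var_mult_add:
  "Poly_Mapping.lookup (var i * f) (Poly_Mapping.single i 1 + b) = Poly_Mapping.lookup f b"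
  by (simp only: var_def lookup_mult lookup_single when_mult eq_commute[of "Poly_Mapping.single i 1"]
      Sum_any_when_equal add_left_cancel mult_1) simp

lemma lookup_var_mult_0:
  assumes "Poly_Mapping.lookup a i = 0"
  shows "Poly_Mapping.lookup (var i * f) a = 0"
proof -
  have "a \<noteq> Poly_Mapping.single i 1 + q" for q
    using assms by (auto simp: lookup_add)
  then show ?thesis
    by (simp only: var_def lookup_mult lookup_single when_mult eq_commute[of "Poly_Mapping.single i 1"]
        Sum_any_when_equal mult_1) (simp add: lookup_single when_def)
qed

text \<open>Splits coefficientwise arguments by whether x_i divides the monomial, matching the two
  lookup rules above.\<close>

lemma expvec_cases:
  fixes a :: expvec
  obtains "Poly_Mapping.lookup a i = 0" | b where "a = Poly_Mapping.single i 1 + b"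
proof (cases "Poly_Mapping.lookup a i = 0")
  case False
  then have "a = Poly_Mapping.single i 1 + (a - Poly_Mapping.single i 1)"
    by (intro poly_mapping_eqI) (auto simp: lookup_add lookup_minus lookup_single when_def)
  then show ?thesis by (rule that(2))
qed (rule that(1))

lemma keys_var_mult:
  assumes "a \<in> Poly_Mapping.keys (var i * f)"
  obtains b where "a = Poly_Mapping.single i 1 + b" "b \<in> Poly_Mapping.keys f"
  using assms
  by (cases a i rule: expvec_cases) (auto simp: in_keys_iff lookup_var_mult_0 lookup_var_mult_add simp del: One_nat_def)

lemma tdeg_add: "tdeg (a + b) = tdeg a + tdeg b"
  unfolding tdeg_def by (rule setsum_keys_plus_distrib) auto

lemma tdeg_single: "tdeg (Poly_Mapping.single i k) = k"
  by (simp add: tdeg_def)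

section \<open>Exchange of two variables and the divided difference\<close>

lemma lookup_swap_exp:
  "Poly_Mapping.lookup (swap_exp j a) i = Poly_Mapping.lookup a (transpose j (Suc j) i)"
proof -
  have "{i. Poly_Mapping.lookup a (transpose j (Suc j) i) \<noteq> 0} = transpose j (Suc j) -` Poly_Mapping.keys a"
    by (auto simp: in_keys_iff)
  then have "finite {i. Poly_Mapping.lookup a (transpose j (Suc j) i) \<noteq> 0}"
    by (simp add: finite_vimageI inj_transpose)
  then show ?thesis by (simp add: swap_exp_def)
qed

lemma swap_exp_swap_exp [simp]: "swap_exp j (swap_exp j a) = a"
  by (intro poly_mapping_eqI) (simp add: lookup_swap_exp)

lemma swap_exp_add: "swap_exp j (a + b) = swap_exp j a + swap_exp j b"
  by (intro poly_mapping_eqI) (simp add: lookup_swap_exp lookup_add)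

lemma swap_exp_single:
  "swap_exp j (Poly_Mapping.single i k) = Poly_Mapping.single (transpose j (Suc j) i) k"
  by (intro poly_mapping_eqI) (auto simp: lookup_swap_exp lookup_single when_def)

lemma lookup_swapvar: "Poly_Mapping.lookup (swapvar j f) a = Poly_Mapping.lookup f (swap_exp j a)"
proof -
  have "{a. Poly_Mapping.lookup f (swap_exp j a) \<noteq> 0} \<subseteq> swap_exp j ` Poly_Mapping.keys f"
    by (auto simp: in_keys_iff intro!: image_eqI[where x = "swap_exp j _"])
  then have "finite {a. Poly_Mapping.lookup f (swap_exp j a) \<noteq> 0}"
    by (rule finite_subset) simp
  then show ?thesis by (simp add: swapvar_def)
qed

lemma swapvar_add: "swapvar j (f + g) = swapvar j f + swapvar j g"
  by (intro poly_mapping_eqI) (simp add: lookup_swapvar lookup_add)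

lemma swapvar_diff: "swapvar j (f - g) = swapvar j f - swapvar j g"
  by (intro poly_mapping_eqI) (simp add: lookup_swapvar lookup_minus)

lemma swapvar_0 [simp]: "swapvar j 0 = 0"
  by (intro poly_mapping_eqI) (simp add: lookup_swapvar)

lemma swapvar_1 [simp]: "swapvar j 1 = 1"
proof -
  have "swap_exp j a = 0 \<longleftrightarrow> a = 0" for a
    by (metis add_cancel_left_left swap_exp_add swap_exp_swap_exp)
  then show ?thesis
    by (intro poly_mapping_eqI) (simp add: lookup_swapvar lookup_one)
qed

lemma swapvar_var_mult: "swapvar j (var i * f) = var (transpose j (Suc j) i) * swapvar j f"
proof (rule poly_mapping_eqI)
  fix a
  show "Poly_Mapping.lookup (swapvar j (var i * f)) a =
    Poly_Mapping.lookup (var (transpose j (Suc j) i) * swapvar j f) a"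
  proof (cases a "transpose j (Suc j) i" rule: expvec_cases)
    case 1
    then show ?thesis by (simp add: lookup_swapvar lookup_var_mult_0 lookup_swap_exp)
  next
    case (2 b)
    then have "swap_exp j a = Poly_Mapping.single i 1 + swap_exp j b"
      by (simp add: swap_exp_add swap_exp_single)
    with 2 show ?thesis
      by (simp only: lookup_swapvar lookup_var_mult_add)
  qed
qed

lemma var_inj: "var i = var j \<longleftrightarrow> i = j"
  by (metis One_nat_def lookup_single_eq lookup_single_not_eq var_def zero_neq_one)

text \<open>The polynomial ring has no zero divisors and the two variables differ, so the quotient
  is unique and exhibiting one suffices.\<close>

lemma divdiff_eqI:
  assumes "(var j - var (Suc j)) * g = f - swapvar j f"
  shows "divdiff j f = g"
  unfolding divdiff_def
proof (rule the_equality)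
  fix g' assume "(var j - var (Suc j)) * g' = f - swapvar j f"
  then have "(var j - var (Suc j)) * g' = (var j - var (Suc j)) * g" using assms by simp
  then show "g' = g" by (simp add: var_inj)
qed (rule assms)

section \<open>The 0-Hecke algebra\<close>

text \<open>A function \<open>F\<close> on permutations stands for the element \<open>\<Sum>\<^sub>w F(w) w\<close> of the 0-Hecke algebra;
  \<open>hecke_left e\<close> and \<open>hecke_right j\<close> are multiplication by a generator from the left and from the right.\<close>

definition hecke_left :: "nat \<Rightarrow> ((nat \<Rightarrow> nat) \<Rightarrow> ipoly) \<Rightarrow> (nat \<Rightarrow> nat) \<Rightarrow> ipoly" where
  "hecke_left e F w = (if bij w \<and> inv w (Suc e) < inv w e then F (transpose e (Suc e) \<circ> w) - F w else 0)"

definition hecke_right :: "nat \<Rightarrow> ((nat \<Rightarrow> nat) \<Rightarrow> ipoly) \<Rightarrow> (nat \<Rightarrow> nat) \<Rightarrow> ipoly" where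
  "hecke_right j F w = (if bij w \<and> w (Suc j) < w j then F (w \<circ> transpose j (Suc j)) - F w else 0)"

definition hecke_factor :: "nat \<Rightarrow> ipoly \<Rightarrow> ((nat \<Rightarrow> nat) \<Rightarrow> ipoly) \<Rightarrow> (nat \<Rightarrow> nat) \<Rightarrow> ipoly" where
  "hecke_factor e x F w = F w + x * hecke_left e F w"

text \<open>The head of the list acts first and is the rightmost factor: the letters
  \<open>[i..<n]\<close> give (1 + x u_{n-1}) ... (1 + x u_i).\<close>

definition hecke_row :: "ipoly \<Rightarrow> nat list \<Rightarrow> ((nat \<Rightarrow> nat) \<Rightarrow> ipoly) \<Rightarrow> (nat \<Rightarrow> nat) \<Rightarrow> ipoly" where
  "hecke_row x es = fold (\<lambda>e. hecke_factor e x) es"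

definition delta_id :: "(nat \<Rightarrow> nat) \<Rightarrow> ipoly" where
  "delta_id w = (if w = id then 1 else 0)"

definition rows :: "nat \<Rightarrow> nat list \<Rightarrow> ((nat \<Rightarrow> nat) \<Rightarrow> ipoly) \<Rightarrow> (nat \<Rightarrow> nat) \<Rightarrow> ipoly" where
  "rows n is = foldr (\<lambda>i. hecke_row (var i) [i..<n]) is"

text \<open>The rows \<open>i\<close>, ..., \<open>n - 1\<close> of the product, row
  \<open>i\<close> leftmost. The case \<open>i = 1\<close> is the whole product; the tails serve
  inductions over rows.\<close>

definition groth_rows :: "nat \<Rightarrow> nat \<Rightarrow> (nat \<Rightarrow> nat) \<Rightarrow> ipoly" where
  "groth_rows n i = rows n [i..<n] delta_id"

section \<open>Relations among the generators\<close>

lemma inv_transpose_comp: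
  assumes "bij w"
  shows "inv (transpose a b \<circ> w) = inv w \<circ> transpose a b"
  using assms by (simp add: o_inv_distrib)

lemma bij_transpose_comp [simp]: "bij (transpose a b \<circ> w) \<longleftrightarrow> bij w"
  by (metis bij_comp bij_transpose comp_assoc fun.map_id transpose_comp_involutory id_comp)

lemma bij_comp_transpose [simp]: "bij (w \<circ> transpose a b) \<longleftrightarrow> bij w"
  by (metis bij_comp bij_transpose comp_assoc transpose_comp_involutory comp_id)

text \<open>If \<open>e\<close> is a left descent of \<open>w\<close>, it is none of
  \<open>transpose e (Suc e) \<circ> w\<close>, so the first term of the outer difference
  vanishes.\<close>

lemma hecke_left_hecke_left: "hecke_left e (hecke_left e F) w = - hecke_left e F w"
  by (simp add: hecke_left_def inv_transpose_comp)

lemma transpose_far_comm: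
  assumes "Suc e < d"
  shows "transpose e (Suc e) \<circ> (transpose d (Suc d) \<circ> w) = transpose d (Suc d) \<circ> (transpose e (Suc e) \<circ> w)"
  using assms by (auto simp: fun_eq_iff Transposition.transpose_def)

lemma hecke_left_comm:
  assumes "Suc e < d"
  shows "hecke_left e (hecke_left d F) = hecke_left d (hecke_left e F)"
  using assms by (auto simp: fun_eq_iff hecke_left_def inv_transpose_comp transpose_far_comm)

lemma transpose_braid:
  "transpose e (Suc e) \<circ> (transpose (Suc e) (Suc (Suc e)) \<circ> (transpose e (Suc e) \<circ> w)) =
   transpose (Suc e) (Suc (Suc e)) \<circ> (transpose e (Suc e) \<circ> (transpose (Suc e) (Suc (Suc e)) \<circ> w))"
  by (auto simp: fun_eq_iff Transposition.transpose_def)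

text \<open>Only the relative order of the positions of \<open>e\<close>, \<open>e + 1\<close>,
  \<open>e + 2\<close> matters. With these named \<open>a\<close>, \<open>b\<close>,
  \<open>c\<close>, each order is settled by expansion and the braid relation of
  transpositions.\<close>

lemma hecke_left_braid:
  "hecke_left e (hecke_left (Suc e) (hecke_left e F)) = hecke_left (Suc e) (hecke_left e (hecke_left (Suc e) F))"
proof
  fix w
  show "hecke_left e (hecke_left (Suc e) (hecke_left e F)) w = hecke_left (Suc e) (hecke_left e (hecke_left (Suc e) F)) w"
  proof (cases "bij w")
    case True
    have ne: "inv w e \<noteq> inv w (Suc e)" "inv w (Suc e) \<noteq> inv w (Suc (Suc e))" "inv w e \<noteq> inv w (Suc (Suc e))"
      using True by (metis bij_inv_eq_iff n_not_Suc_n Suc_n_not_le_n le_SucI order_refl)+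
    define a b c where "a = inv w e" "b = inv w (Suc e)" "c = inv w (Suc (Suc e))"
    note abc = a_b_c_def[symmetric]
    show ?thesis using True ne
      by (simp add: hecke_left_def inv_transpose_comp abc) (auto simp: transpose_braid)
  qed (simp add: hecke_left_def)
qed

text \<open>No number lies strictly between \<open>j\<close> and \<open>Suc j\<close>, so exchanging
  them affects no other comparison. Used for values and for positions.\<close>

lemma transpose_Suc_less_iff:
  fixes x y :: nat
  assumes "x \<noteq> y" "{x, y} \<noteq> {j, Suc j}"
  shows "transpose j (Suc j) x < transpose j (Suc j) y \<longleftrightarrow> x < y"
  using assms unfolding Transposition.transpose_def doubleton_eq_iff by (simp split: if_splits) linarith

text \<open>Associativity of the product. The two descent conditions are independent unless
  positions \<open>j\<close>, \<open>Suc j\<close> carry the values \<open>e\<close>,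
  \<open>Suc e\<close>; then both swaps have the same effect on \<open>w\<close>.\<close>

lemma hecke_left_hecke_right_comm: "hecke_left e (hecke_right j F) = hecke_right j (hecke_left e F)"
proof
  fix w
  show "hecke_left e (hecke_right j F) w = hecke_right j (hecke_left e F) w"
  proof (cases "bij w")
    case True
    have inj: "w x = w y \<longleftrightarrow> x = y" for x y using True by (metis bij_inv_eq_iff)
    have iw: "inv w x = y \<longleftrightarrow> w y = x" for x y using True by (metis bij_inv_eq_iff)
    have inv2: "inv (w \<circ> transpose j (Suc j)) = transpose j (Suc j) \<circ> inv w"
      using True by (simp add: o_inv_distrib)
    show ?thesis
    proof (cases "{w j, w (Suc j)} = {e, Suc e}")
      case eq: True
      have c: "transpose e (Suc e) \<circ> w = w \<circ> transpose j (Suc j)"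
        using eq True by (auto simp: transpose_comp_eq doubleton_eq_iff transpose_commute iw[THEN iffD2])
      consider "w j = e" "w (Suc j) = Suc e" "inv w e = j" "inv w (Suc e) = Suc j"
        | "w (Suc j) = e" "w j = Suc e" "inv w e = Suc j" "inv w (Suc e) = j"
        using eq by (auto simp: doubleton_eq_iff iw)
      then show ?thesis
        by cases (simp_all add: hecke_left_def hecke_right_def True c, simp_all add: inv_transpose_comp True inv2)
    next
      case False
      have 1: "transpose e (Suc e) (w (Suc j)) < transpose e (Suc e) (w j) \<longleftrightarrow> w (Suc j) < w j"
        using False inj[of j "Suc j"] by (intro transpose_Suc_less_iff) auto
      have "{inv w (Suc e), inv w e} \<noteq> {j, Suc j}"
        using False by (auto simp: doubleton_eq_iff iw)
      moreover have "inv w (Suc e) \<noteq> inv w e" using iw[of e] iw[of "Suc e"] by force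
      ultimately have 2: "transpose j (Suc j) (inv w (Suc e)) < transpose j (Suc j) (inv w e) \<longleftrightarrow> inv w (Suc e) < inv w e"
        by (intro transpose_Suc_less_iff)
      show ?thesis using True
        by (simp add: hecke_left_def hecke_right_def inv_transpose_comp inv2 1 2 comp_assoc)
    qed
  qed (simp add: hecke_left_def hecke_right_def)
qed

text \<open>Both sides are the generator itself, \<open>delta_id\<close> being the unit. This turns
  a generator entering from the right into one on the left.\<close>

lemma hecke_left_delta_id: "hecke_left j delta_id = hecke_right j delta_id"
proof
  fix w :: "nat \<Rightarrow> nat"
  have 1: "transpose j (Suc j) \<circ> w = id \<longleftrightarrow> w = transpose j (Suc j)"
    by (metis comp_assoc comp_id id_comp transpose_comp_involutory)
  have 2: "w \<circ> transpose j (Suc j) = id \<longleftrightarrow> w = transpose j (Suc j)"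
    by (metis comp_assoc comp_id id_comp transpose_comp_involutory)
  show "hecke_left j delta_id w = hecke_right j delta_id w"
    by (cases "w = id \<or> w = transpose j (Suc j)") (auto simp: hecke_left_def hecke_right_def delta_id_def 1 2)
qed

section \<open>Linearity and commutation of factors, rows and products\<close>

lemma hecke_left_linear:
  "hecke_left e (\<lambda>w. F w + c * G w) = (\<lambda>w. hecke_left e F w + c * hecke_left e G w)"
  by (auto simp: hecke_left_def fun_eq_iff algebra_simps)

lemma hecke_right_linear:
  "hecke_right e (\<lambda>w. F w + c * G w) = (\<lambda>w. hecke_right e F w + c * hecke_right e G w)"
  by (auto simp: hecke_right_def fun_eq_iff algebra_simps)

lemma factor_altdef: "hecke_factor e x F = (\<lambda>w. F w + x * hecke_left e F w)"
  by (simp add: hecke_factor_def fun_eq_iff)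

lemma factor_linear:
  "hecke_factor e x (\<lambda>w. F w + c * G w) = (\<lambda>w. hecke_factor e x F w + c * hecke_factor e x G w)"
  by (simp add: factor_altdef hecke_left_linear fun_eq_iff algebra_simps)

lemma row_Nil [simp]: "hecke_row x [] F = F"
  by (simp add: hecke_row_def)

lemma row_Cons: "hecke_row x (e # es) F = hecke_row x es (hecke_factor e x F)"
  by (simp add: hecke_row_def)

lemma row_snoc: "hecke_row x (es @ [e]) F = hecke_factor e x (hecke_row x es F)"
  by (simp add: hecke_row_def)

lemma row_linear:
  "hecke_row x es (\<lambda>w. F w + c * G w) = (\<lambda>w. hecke_row x es F w + c * hecke_row x es G w)"
  by (induction es arbitrary: F G) (simp_all add: row_Cons factor_linear)

lemma rows_Nil [simp]: "rows n [] F = F"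
  by (simp add: rows_def)

lemma rows_Cons: "rows n (i # is) F = hecke_row (var i) [i..<n] (rows n is F)"
  by (simp add: rows_def)

lemma rows_append: "rows n (is @ js) F = rows n is (rows n js F)"
  by (simp add: rows_def)

lemma rows_linear:
  "rows n is (\<lambda>w. F w + c * G w) = (\<lambda>w. rows n is F w + c * rows n is G w)"
  by (induction "is" arbitrary: F G) (simp_all add: rows_Cons row_linear)

lemma factor_hecke_right: "hecke_factor e x (hecke_right j F) = hecke_right j (hecke_factor e x F)"
  by (simp add: factor_altdef hecke_right_linear hecke_left_hecke_right_comm)

lemma row_hecke_right: "hecke_row x es (hecke_right j F) = hecke_right j (hecke_row x es F)"
  by (induction es arbitrary: F) (simp_all add: row_Cons factor_hecke_right)

lemma rows_hecke_right: "rows n is (hecke_right j F) = hecke_right j (rows n is F)"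
  by (induction "is") (simp_all add: rows_Cons row_hecke_right)

lemma factor_hecke_left:
  assumes "Suc j < e"
  shows "hecke_factor e x (hecke_left j F) = hecke_left j (hecke_factor e x F)"
  using assms by (simp add: factor_altdef hecke_left_linear hecke_left_comm)

lemma row_hecke_left:
  assumes "\<forall>e\<in>set es. Suc j < e"
  shows "hecke_row x es (hecke_left j F) = hecke_left j (hecke_row x es F)"
  using assms by (induction es arbitrary: F) (simp_all add: row_Cons factor_hecke_left)

lemma rows_hecke_left:
  assumes "\<forall>i\<in>set is. Suc j < i"
  shows "rows n is (hecke_left j F) = hecke_left j (rows n is F)"
  using assms
proof (induction "is")
  case (Cons i "is")
  then have "\<forall>e\<in>set [i..<n]. Suc j < e" by auto
  with Cons show ?case by (simp add: rows_Cons row_hecke_left)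
qed simp

lemma row_factor:
  assumes "\<forall>e\<in>set es. Suc j < e"
  shows "hecke_row x es (hecke_factor j y F) = hecke_factor j y (hecke_row x es F)"
  using row_hecke_left[OF assms] by (simp add: factor_altdef row_linear)

text \<open>Up to the factor on the left, the right-hand side is symmetric in \<open>x\<close> and \<open>y\<close>.  It replaces the usual
  Yang-Baxter equation, whose use here would need inverses of the factors.\<close>

lemma yang_baxter:
  "hecke_factor e x (hecke_factor (Suc e) y (hecke_factor e y F)) =
   hecke_factor (Suc e) y (\<lambda>w. F w + ((x + y - x * y) * hecke_left e F w
      + (x * y) * (hecke_left e (hecke_left (Suc e) F) w - hecke_left (Suc e) (hecke_left e F) w)))"
proof -
  have sq: "hecke_left d (hecke_left d G) = (\<lambda>w. 0 + (-1) * hecke_left d G w)" for d G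
    by (simp add: fun_eq_iff hecke_left_hecke_left)
  have M: "(\<lambda>w. F w + ((x + y - x * y) * hecke_left e F w
      + (x * y) * (hecke_left e (hecke_left (Suc e) F) w - hecke_left (Suc e) (hecke_left e F) w))) =
     (\<lambda>w. ((F w + (x + y - x * y) * hecke_left e F w) + (x * y) * hecke_left e (hecke_left (Suc e) F) w)
         + (- (x * y)) * hecke_left (Suc e) (hecke_left e F) w)"
    by (simp add: fun_eq_iff algebra_simps)
  have Z: "hecke_left d (\<lambda>w. 0 + c * G w) = (\<lambda>w. c * hecke_left d G w)" for d c G
    by (auto simp: hecke_left_def fun_eq_iff algebra_simps)
  show ?thesis
    unfolding M factor_altdef hecke_left_linear
    by (simp add: sq Z hecke_left_braid fun_eq_iff algebra_simps)
qed

text \<open>The outer factor \<open>i\<close> passes the letters beyond \<open>Suc i\<close> of the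
  inner row. Then \<open>yang_baxter\<close> turns the three lowest factors into one factor
  \<open>Suc i\<close> on a term symmetric in \<open>x\<close> and \<open>y\<close>, leaving two
  rows from \<open>Suc i\<close> on, which commute by induction.\<close>

lemma row_swap:
  "hecke_row x [i..<n] (hecke_row y [i..<n] F) = hecke_row y [i..<n] (hecke_row x [i..<n] F)"
proof (induction "n - i" arbitrary: i F)
  case (Suc k)
  then have i: "i < n" "k = n - Suc i" by auto
  have split: "hecke_row z [i..<n] G = hecke_row z [Suc i..<n] (hecke_factor i z G)" for z G
    using i by (simp add: upt_conv_Cons row_Cons)
  show ?case
  proof (cases "Suc i < n")
    \<comment> \<open>Only the letter \<open>i\<close> is left, and factors in the same generator
      commute.\<close>
    case False
    then have "n = Suc i" using i by simp
    then have "hecke_row x [i..<n] (hecke_row y [i..<n] F) = hecke_factor i x (hecke_factor i y F)" for x y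
      by (simp add: row_Cons)
    moreover have "hecke_factor i x (hecke_factor i y F) = hecke_factor i y (hecke_factor i x F)" for x y
      by (simp add: factor_altdef hecke_left_linear fun_eq_iff hecke_left_hecke_left algebra_simps)
    ultimately show ?thesis by simp
  next
    case True
    define M where "M x y = (\<lambda>w. F w + ((x + y - x * y) * hecke_left i F w
      + (x * y) * (hecke_left i (hecke_left (Suc i) F) w - hecke_left (Suc i) (hecke_left i F) w)))" for x y :: ipoly
    have "hecke_row x [i..<n] (hecke_row y [i..<n] F) = hecke_row x [Suc i..<n] (hecke_row y [Suc i..<n] (M x y))" for x y
    proof -
      have 1: "hecke_row z [Suc i..<n] G = hecke_row z [Suc (Suc i)..<n] (hecke_factor (Suc i) z G)" for z G
        using True by (simp add: upt_conv_Cons row_Cons)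
      have "hecke_row x [i..<n] (hecke_row y [i..<n] F) =
          hecke_row x [Suc i..<n] (hecke_factor i x (hecke_row y [Suc (Suc i)..<n] (hecke_factor (Suc i) y (hecke_factor i y F))))"
        by (simp only: split 1)
      also have "\<dots> = hecke_row x [Suc i..<n] (hecke_row y [Suc (Suc i)..<n] (hecke_factor i x (hecke_factor (Suc i) y (hecke_factor i y F))))"
        by (simp add: row_factor)
      also have "\<dots> = hecke_row x [Suc i..<n] (hecke_row y [Suc i..<n] (M x y))"
        by (simp only: 1[of y] yang_baxter M_def)
      finally show ?thesis .
    qed
    moreover have "M x y = M y x" by (simp add: M_def algebra_simps)
    ultimately show ?thesis using Suc(1)[OF i(2)] by simp
  qed
qed simp

section \<open>Exchange of variables in the product, and its divided differences\<close>

lemma swapvar_factor: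
  "(\<lambda>w. swapvar j (hecke_factor e (var i) F w)) = hecke_factor e (var (transpose j (Suc j) i)) (\<lambda>w. swapvar j (F w))"
  by (auto simp: fun_eq_iff hecke_factor_def hecke_left_def swapvar_add swapvar_var_mult swapvar_diff)

text \<open>The exchange acts on coefficients only, so it passes the generators and merely renames
  the variable of the row.\<close>

lemma swapvar_row:
  "(\<lambda>w. swapvar j (hecke_row (var i) es F w)) = hecke_row (var (transpose j (Suc j) i)) es (\<lambda>w. swapvar j (F w))"
  by (induction es arbitrary: F) (simp_all add: row_Cons swapvar_factor)

lemma swapvar_rows:
  assumes "j \<notin> set is" "Suc j \<notin> set is"
  shows "(\<lambda>w. swapvar j (rows n is F w)) = rows n is (\<lambda>w. swapvar j (F w))"
  using assms
proof (induction "is")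
  case (Cons i "is")
  then have "transpose j (Suc j) i = i" by (simp add: transpose_apply_other)
  with Cons show ?case by (simp add: rows_Cons swapvar_row)
qed simp

lemma swapvar_delta_id: "(\<lambda>w. swapvar j (delta_id w)) = delta_id"
  by (simp add: fun_eq_iff delta_id_def)

lemma groth_rows_ge: "n \<le> i \<Longrightarrow> groth_rows n i = delta_id"
  by (simp add: groth_rows_def)

lemma groth_rows_rec: "groth_rows n i = hecke_row (var i) [i..<n] (groth_rows n (Suc i))"
  by (cases "i < n") (simp_all add: groth_rows_def upt_conv_Cons rows_Cons)

lemma groth_rows_split:
  "1 \<le> j \<Longrightarrow> j < n \<Longrightarrow> groth_rows n 1 = rows n [1..<j] (groth_rows n j)"
  unfolding groth_rows_def rows_append[symmetric]
  using upt_add_eq_append[of 1 j "n - j"] by simp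

text \<open>Multiplying the whole product by \<open>1 + x\<^sub>j\<^sub>+\<^sub>1 u\<^sub>j\<close> from the right turns its rows \<open>j\<close> and \<open>j + 1\<close> into
  two rows on the same letters, and these commute.\<close>

lemma groth_rows_symmetric:
  assumes "1 \<le> j" "j < n"
  shows "swapvar j (groth_rows n 1 w + var (Suc j) * hecke_right j (groth_rows n 1) w)
    = groth_rows n 1 w + var (Suc j) * hecke_right j (groth_rows n 1) w"
proof -
  define T where "T = groth_rows n (Suc (Suc j))"
  \<comment> \<open>The generator from the right meets the unit first and then passes, as a left
    factor, through later rows whose letters are far from \<open>j\<close>.\<close>
  have T: "hecke_right j T = hecke_left j T"
  proof -
    have "hecke_right j T = rows n [Suc (Suc j)..<n] (hecke_left j delta_id)"
      by (simp add: T_def groth_rows_def rows_hecke_right hecke_left_delta_id)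
    also have "\<dots> = hecke_left j T"
      unfolding T_def groth_rows_def by (rule rows_hecke_left) auto
    finally show ?thesis .
  qed
  \<comment> \<open>Rows \<open>j\<close> and \<open>Suc j\<close>, both starting at letter
    \<open>j\<close>. The earlier rows and \<open>T\<close> do not involve their variables, so the
    exchange only interchanges \<open>x\<close> and \<open>y\<close>.\<close>
  define Q where "Q x y = rows n [1..<j] (hecke_row x [j..<n] (hecke_row y [j..<n] T))" for x y
  have "(\<lambda>w. groth_rows n 1 w + var (Suc j) * hecke_right j (groth_rows n 1) w) =
      rows n [1..<j] (hecke_row (var j) [j..<n] (hecke_row (var (Suc j)) [Suc j..<n] (hecke_factor j (var (Suc j)) T)))"
    by (simp only: groth_rows_split[OF assms] groth_rows_rec[of n j] groth_rows_rec[of n "Suc j"] T_def[symmetric]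
        rows_hecke_right[symmetric] row_hecke_right[symmetric] rows_linear[symmetric] row_linear[symmetric] T factor_altdef)
  also have "\<dots> = Q (var j) (var (Suc j))"
    using assms(2) by (simp add: Q_def upt_conv_Cons row_Cons)
  finally have eq: "(\<lambda>w. groth_rows n 1 w + var (Suc j) * hecke_right j (groth_rows n 1) w) = Q (var j) (var (Suc j))" .
  have sT: "(\<lambda>w. swapvar j (T w)) = T"
    unfolding T_def groth_rows_def by (simp add: swapvar_rows swapvar_delta_id)
  have "(\<lambda>w. swapvar j (Q (var j) (var (Suc j)) w)) = Q (var (Suc j)) (var j)"
    unfolding Q_def by (simp add: swapvar_rows swapvar_row sT)
  also have "\<dots> = Q (var j) (var (Suc j))" by (simp add: Q_def row_swap)
  finally show ?thesis by (simp only: eq[THEN fun_cong] fun_eq_iff)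
qed

text \<open>Write P for the product and u for w s_j. The symmetry at w says that P(w) is symmetric;
  at u it says that (1 - x_{j+1}) P(u) + x_{j+1} P(w) is. So f = (1 - x_{j+1}) P(u) satisfies f -
  s_j f = (x_j - x_{j+1}) P(w).\<close>

lemma bdivdiff_groth_rows:
  assumes "1 \<le> j" "j < n" "bij w" "w j < w (Suc j)"
  shows "bdivdiff j (groth_rows n 1 (w \<circ> transpose j (Suc j))) = groth_rows n 1 w"
proof -
  define u where "u = w \<circ> transpose j (Suc j)"
  define P where "P = groth_rows n 1"
  have hw: "hecke_right j P w = 0" using assms(4) by (simp add: hecke_right_def)
  have hu: "hecke_right j P u = P w - P u"
    using assms(3,4) by (simp add: hecke_right_def u_def comp_assoc)
  have sw: "swapvar j (P w) = P w"
    using groth_rows_symmetric[OF assms(1,2), of w] hw by (simp add: P_def)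
  have su: "swapvar j ((1 - var (Suc j)) * P u) = (1 - var (Suc j)) * P u + var (Suc j) * P w - var j * P w"
  proof -
    have eq: "P u + var (Suc j) * hecke_right j P u = (1 - var (Suc j)) * P u + var (Suc j) * P w"
      by (simp add: hu algebra_simps)
    have "swapvar j (P u + var (Suc j) * hecke_right j P u) = P u + var (Suc j) * hecke_right j P u"
      using groth_rows_symmetric[OF assms(1,2), of u] by (simp only: P_def)
    then have "swapvar j ((1 - var (Suc j)) * P u) + var j * P w = (1 - var (Suc j)) * P u + var (Suc j) * P w"
      by (simp only: eq swapvar_add swapvar_var_mult sw transpose_apply_second)
    then show ?thesis by (simp only: eq_diff_eq)
  qed
  show ?thesis
    unfolding bdivdiff_def u_def[symmetric] P_def[symmetric]
    by (rule divdiff_eqI, simp only: su) (simp add: algebra_simps)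
qed

section \<open>Exponent bounds and signs\<close>

lemma permutes_transpose_comp:
  assumes "w permutes {1..n}" "1 \<le> k" "k < n"
  shows "transpose k (Suc k) \<circ> w permutes {1..n}"
  using assms by (intro permutes_compose permutes_swap_id) auto

lemma sign_transpose_comp:
  assumes "w permutes {1..n}"
  shows "sign (transpose k (Suc k) \<circ> w) = - sign w"
proof -
  have "permutation w" using assms by (auto simp: permutation_permutes)
  then show ?thesis by (simp add: sign_compose permutation_swap_id sign_swap_id)
qed

lemma row_step:
  "i \<le> k \<Longrightarrow> hecke_row x [i..<Suc k] F = hecke_factor k x (hecke_row x [i..<k] F)"
  by (simp add: row_snoc)

text \<open>Row \<open>m\<close> of the upper closure of the Rothe diagram, each column recorded by
  the position of its value.\<close>

definition exceeded :: "nat \<Rightarrow> (nat \<Rightarrow> nat) \<Rightarrow> nat \<Rightarrow> nat set" where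
  "exceeded n w m = {p. m < p \<and> p \<le> n \<and> (\<exists>q\<in>{m..<p}. w p < w q)}"

lemma finite_exceeded [simp]: "finite (exceeded n w m)"
  by (rule finite_subset[of _ "{..n}"]) (auto simp: exceeded_def)

text \<open>Undoing a generator at a left descent removes one inversion and creates none, so
  \<open>exceeded\<close> can only shrink.\<close>

lemma transpose_comp_less:
  assumes "w permutes {1..n}" "inv w (Suc k) < inv w k" "p < q"
    "(transpose k (Suc k) \<circ> w) q < (transpose k (Suc k) \<circ> w) p"
  shows "w q < w p"
proof -
  have iw: "inv w x = y \<longleftrightarrow> w y = x" for x y using assms(1) by (metis permutes_inverses)
  have ne: "w p \<noteq> w q" using assms(3) by (metis iw less_irrefl)
  show ?thesis
  proof (cases "{w q, w p} = {k, Suc k}")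
    case True
    then show ?thesis
      using assms(2,3) iw[of k p] iw[of k q] iw[of "Suc k" p] iw[of "Suc k" q] by (auto simp: doubleton_eq_iff)
  next
    case False
    then show ?thesis using assms(4) ne transpose_Suc_less_iff[of "w q" "w p" k] by auto
  qed
qed

text \<open>Row \<open>i\<close> contributes at most one to the exponent of x_i per exceeded
  position, and later rows are bounded by induction. The fixed points are carried along because they
  force the value \<open>Suc k\<close> to stand at position \<open>i\<close> or later.\<close>

lemma keys_groth_rows:
  assumes "w permutes {1..n}" "a \<in> Poly_Mapping.keys (groth_rows n i w)" "1 \<le> i"
  shows "(\<forall>m<i. w m = m) \<and> (\<forall>m<i. Poly_Mapping.lookup a m = 0)
    \<and> (\<forall>m. Poly_Mapping.lookup a m \<le> card (exceeded n w m))"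
  using assms
proof (induction "n - i" arbitrary: i w a)
  case 0
  then have "w = id" "a = 0" by (auto simp: groth_rows_ge delta_id_def in_keys_iff lookup_one when_def split: if_splits)
  then show ?case by simp
next
  case (Suc d)
  then have i: "i < n" "d = n - Suc i" by auto
  \<comment> \<open>A letter \<open>k\<close> chosen in row \<open>i\<close> leaves the value \<open>k\<close> to the right of \<open>k + 1\<close>, so it accounts for a
    new element of \<open>C (Suc k) w\<close>.\<close>
  define C where "C k w = {p\<in>exceeded n w i. w p < k}" for k w
  have finC [simp]: "finite (C k w)" for k w by (simp add: C_def)
  \<comment> \<open>Strengthened claim for the partial row with letters below \<open>k\<close>: only
    exceeded positions with values below \<open>k\<close> count for x_i.\<close>
  have "(\<forall>m<i. w m = m) \<and> (\<forall>m<i. Poly_Mapping.lookup a m = 0)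
      \<and> Poly_Mapping.lookup a i \<le> card (C k w)
      \<and> (\<forall>m>i. Poly_Mapping.lookup a m \<le> card (exceeded n w m))"
    if "i \<le> k" "k \<le> n" "w permutes {1..n}"
      "a \<in> Poly_Mapping.keys (hecke_row (var i) [i..<k] (groth_rows n (Suc i)) w)" for k w a
    using that
  proof (induction k arbitrary: w a rule: dec_induct)
    case base
    then show ?case using Suc.hyps(1)[OF i(2), of w a] Suc.prems(3) by (auto simp: less_Suc_eq)
  next
    case (step k)
    define H where "H = hecke_row (var i) [i..<k] (groth_rows n (Suc i))"
    define v where "v = transpose k (Suc k) \<circ> w"
    have IH: "(\<forall>m<i. w m = m) \<and> (\<forall>m<i. Poly_Mapping.lookup a m = 0)
      \<and> Poly_Mapping.lookup a i \<le> card (C k w)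
      \<and> (\<forall>m>i. Poly_Mapping.lookup a m \<le> card (exceeded n w m))"
      if "w permutes {1..n}" "a \<in> Poly_Mapping.keys (H w)" for w a
      using step.IH that step.prems(1) by (simp add: H_def)
    have k: "1 \<le> k" "k < n" using step.hyps step.prems Suc.prems(3) by auto
    have pv: "v permutes {1..n}" unfolding v_def by (rule permutes_transpose_comp[OF step.prems(2) k])
    have iw: "inv w x = y \<longleftrightarrow> w y = x" for x y using step.prems(2) by (metis permutes_inverses)
    have mono: "card (C k w) \<le> card (C (Suc k) w)"
      by (intro card_mono) (auto simp: C_def)
    have "Poly_Mapping.keys (hecke_row (var i) [i..<Suc k] (groth_rows n (Suc i)) w)
      \<subseteq> Poly_Mapping.keys (H w) \<union> Poly_Mapping.keys (var i * hecke_left k H w)"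
      unfolding row_step[OF step.hyps(1)] hecke_factor_def H_def[symmetric] by (rule keys_add)
    then consider "a \<in> Poly_Mapping.keys (H w)" | "a \<in> Poly_Mapping.keys (var i * hecke_left k H w)"
      using step.prems(3) by blast
    then show ?case
    proof cases
      case 1
      then show ?thesis using IH[OF step.prems(2)] mono by fastforce
    next
      case 2
      then obtain b where a: "a = Poly_Mapping.single i 1 + b" and b: "b \<in> Poly_Mapping.keys (hecke_left k H w)"
        by (rule keys_var_mult)
      from b have desc: "inv w (Suc k) < inv w k" and b': "b \<in> Poly_Mapping.keys (H v) \<union> Poly_Mapping.keys (H w)"
        using keys_diff[of "H v" "H w"] by (auto simp: hecke_left_def v_def split: if_splits)
      have la: "Poly_Mapping.lookup a m = (if m = i then Suc (Poly_Mapping.lookup b m) else Poly_Mapping.lookup b m)" for m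
        by (simp add: a lookup_add lookup_single when_def)
      have vw: "v q < v p \<Longrightarrow> p < q \<Longrightarrow> w q < w p" for p q
        using transpose_comp_less[OF step.prems(2) desc] by (simp add: v_def)
      have ex: "exceeded n v m \<subseteq> exceeded n w m" for m
        unfolding exceeded_def using vw by (auto; metis atLeastLessThan_iff)
      then have cex: "card (exceeded n v m) \<le> card (exceeded n w m)" for m by (intro card_mono) auto
      have Ceq: "C k v \<subseteq> C k w"
        unfolding C_def using ex[of i] by (auto simp: v_def Transposition.transpose_def split: if_splits)
      then have cC: "card (C k v) \<le> card (C k w)" by (intro card_mono) auto
      have P: "(\<forall>m<i. w m = m) \<and> (\<forall>m<i. Poly_Mapping.lookup b m = 0)
          \<and> Poly_Mapping.lookup b i \<le> card (C k w)
          \<and> (\<forall>m>i. Poly_Mapping.lookup b m \<le> card (exceeded n w m))"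
        using b'
      proof
        assume "b \<in> Poly_Mapping.keys (H w)"
        then show ?thesis using IH[OF step.prems(2)] by fastforce
      next
        assume "b \<in> Poly_Mapping.keys (H v)"
        note IHv = IH[OF pv this]
        have "w m = m" if "m < i" for m
        proof -
          have "v m = m" using IHv that by blast
          then have "w m = transpose k (Suc k) m" unfolding v_def by (metis comp_apply transpose_involutory)
          then show ?thesis using that step.hyps(1) by simp
        qed
        then show ?thesis using IHv cC cex by (meson order_trans)
      qed
      have "inv w k \<in> C (Suc k) w"
      proof -
        have "inv w (Suc k) \<ge> i"
        proof (rule ccontr)
          assume "\<not> ?thesis"
          then have "w (inv w (Suc k)) < i" using P by auto
          then show False using iw[of "Suc k" "inv w (Suc k)"] step.hyps(1) by simp
        qed
        moreover have "inv w k \<le> n"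
          using k permutes_in_image[OF permutes_inv[OF step.prems(2)], of k] by auto
        moreover have "w (inv w k) = k" "w (inv w (Suc k)) = Suc k" using iw by blast+
        ultimately show ?thesis using desc
          by (auto simp: C_def exceeded_def intro!: bexI[of _ "inv w (Suc k)"])
      qed
      moreover have "inv w k \<notin> C k w" using iw[of k "inv w k"] by (auto simp: C_def)
      ultimately have "C k w \<subset> C (Suc k) w" by (auto simp: C_def)
      then have "card (C k w) < card (C (Suc k) w)" by (intro psubset_card_mono) auto
      then show ?thesis using P la by (auto simp: less_Suc_eq_le)
    qed
  qed
  from this[of n w a] have A: "(\<forall>m<i. w m = m) \<and> (\<forall>m<i. Poly_Mapping.lookup a m = 0)
      \<and> Poly_Mapping.lookup a i \<le> card (C n w)
      \<and> (\<forall>m>i. Poly_Mapping.lookup a m \<le> card (exceeded n w m))"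
    using Suc.prems i(1) by (simp add: groth_rows_rec[of n i])
  have "card (C n w) \<le> card (exceeded n w i)" by (intro card_mono) (auto simp: C_def)
  with A show ?case by (metis le_trans linorder_cases zero_le)
qed

text \<open>Since \<open>sign w\<close> is -1 to the length of \<open>w\<close>, nonnegativity of
  this number says that the signs alternate with the degree.\<close>

definition signed_coeff :: "(nat \<Rightarrow> nat) \<Rightarrow> ipoly \<Rightarrow> expvec \<Rightarrow> int" where
  "signed_coeff w f a = sign w * (-1) ^ tdeg a * Poly_Mapping.lookup f a"

lemma signed_coeff_factor_0:
  assumes "Poly_Mapping.lookup a i = 0"
  shows "signed_coeff w (hecke_factor k (var i) F w) a = signed_coeff w (F w) a"
  using assms by (simp add: signed_coeff_def hecke_factor_def lookup_add lookup_var_mult_0)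

text \<open>The new variable flips the degree sign; the swap flips \<open>sign w\<close>, and the
  square relation brings its own minus. Hence all three terms enter with a plus and cannot
  cancel.\<close>

lemma signed_coeff_factor_desc:
  assumes "w permutes {1..n}" "inv w (Suc k) < inv w k"
  shows "signed_coeff w (hecke_factor k (var i) F w) (Poly_Mapping.single i 1 + b) =
    signed_coeff w (F w) (Poly_Mapping.single i 1 + b)
      + signed_coeff (transpose k (Suc k) \<circ> w) (F (transpose k (Suc k) \<circ> w)) b + signed_coeff w (F w) b"
  using assms permutes_bij[OF assms(1)]
  by (simp add: signed_coeff_def hecke_factor_def hecke_left_def lookup_add[of "F w"] lookup_var_mult_add lookup_minus
      sign_transpose_comp tdeg_add tdeg_single del: One_nat_def) (simp add: algebra_simps)

lemma signed_coeff_row_nonneg: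
  assumes "\<And>w a. w permutes {1..n} \<Longrightarrow> 0 \<le> signed_coeff w (F w) a" "1 \<le> i" "i \<le> k" "k \<le> n" "w permutes {1..n}"
  shows "0 \<le> signed_coeff w (hecke_row (var i) [i..<k] F w) a"
  using assms(3,4,5)
proof (induction k arbitrary: w a rule: dec_induct)
  case base
  then show ?case using assms(1) by simp
next
  case (step k)
  define H where "H = hecke_row (var i) [i..<k] F"
  have IH: "w permutes {1..n} \<Longrightarrow> 0 \<le> signed_coeff w (H w) a" for w a using step by (simp add: H_def)
  have k: "1 \<le> k" "k < n" using step.hyps step.prems assms(2) by auto
  show ?case unfolding row_step[OF step.hyps(1)] H_def[symmetric]
  proof (cases a i rule: expvec_cases)
    case 1
    then show "0 \<le> signed_coeff w (hecke_factor k (var i) H w) a" using IH step.prems(2) by (simp add: signed_coeff_factor_0)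
  next
    case (2 b)
    show "0 \<le> signed_coeff w (hecke_factor k (var i) H w) a"
    proof (cases "inv w (Suc k) < inv w k")
      case True
      then show ?thesis unfolding 2 signed_coeff_factor_desc[OF step.prems(2) True]
        by (intro add_nonneg_nonneg IH step.prems(2) permutes_transpose_comp k)
    next
      case False
      then show ?thesis using IH step.prems(2) by (simp add: hecke_factor_def hecke_left_def)
    qed
  qed
qed

lemma signed_coeff_groth_rows_nonneg:
  assumes "w permutes {1..n}" "1 \<le> i"
  shows "0 \<le> signed_coeff w (groth_rows n i w) a"
  using assms
proof (induction "n - i" arbitrary: i w a)
  case 0
  then show ?case by (auto simp: groth_rows_ge delta_id_def signed_coeff_def lookup_one when_def tdeg_def)
next
  case (Suc d)
  then show ?case
    unfolding groth_rows_rec[of n i] by (intro signed_coeff_row_nonneg) auto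
qed

section \<open>Existence and uniqueness of Grothendieck polynomials\<close>

text \<open>The rows after \<open>i\<close> fix \<open>i\<close>, and a letter \<open>k\<close> can
  raise the value at \<open>i\<close> only from \<open>k\<close> to \<open>Suc k\<close>.\<close>

lemma row_groth_rows_support:
  assumes "1 \<le> i" "i \<le> k" "k \<le> n" "w permutes {1..n}" "hecke_row (var i) [i..<k] (groth_rows n (Suc i)) w \<noteq> 0"
  shows "w i \<le> k"
  using assms(2-)
proof (induction k arbitrary: w rule: dec_induct)
  case base
  then obtain a where "a \<in> Poly_Mapping.keys (groth_rows n (Suc i) w)"
    by (metis all_not_in_conv keys_eq_empty row_Nil upt_rec less_irrefl)
  then show ?case using keys_groth_rows[OF base(2)] by fastforce
next
  case (step k)
  define H where "H = hecke_row (var i) [i..<k] (groth_rows n (Suc i))"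
  have "H w \<noteq> 0 \<or> H (transpose k (Suc k) \<circ> w) \<noteq> 0"
    using step.prems(3) unfolding row_step[OF step.hyps(1)] H_def[symmetric]
    by (auto simp: hecke_factor_def hecke_left_def split: if_splits)
  then show ?case
  proof
    assume "H w \<noteq> 0"
    then show ?thesis using step.IH step.prems unfolding H_def by (simp add: le_SucI)
  next
    assume "H (transpose k (Suc k) \<circ> w) \<noteq> 0"
    moreover have "transpose k (Suc k) \<circ> w permutes {1..n}"
      using step.hyps step.prems assms(1) by (intro permutes_transpose_comp) auto
    ultimately have "(transpose k (Suc k) \<circ> w) i \<le> k"
      using step.IH step.prems(1) unfolding H_def by (meson Suc_leD)
    then show ?thesis by (auto simp: Transposition.transpose_def split: if_splits)
  qed
qed

section \<open>The longest permutation of a block \<open>{i..n}\<close> and its coefficient\<close>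

definition rev_from :: "nat \<Rightarrow> nat \<Rightarrow> nat \<Rightarrow> nat" where
  "rev_from n i m = (if i \<le> m \<and> m \<le> n then n + i - m else m)"

lemma rev_from_permutes:
  assumes "1 \<le> i"
  shows "rev_from n i permutes {1..n}"
proof -
  have "rev_from n i (rev_from n i m) = m" for m by (auto simp: rev_from_def)
  then show ?thesis unfolding permutes_def using assms by (metis atLeastAtMost_iff le_trans rev_from_def)
qed

lemma longest_permutes: "longest n permutes {1..n}"
proof -
  have "longest n = rev_from n 1" by (auto simp: longest_def rev_from_def)
  then show ?thesis using rev_from_permutes by simp
qed

text \<open>Reversing the block needs every letter of every row, so a single choice of letters
  contributes.\<close>

lemma groth_rows_rev_from:
  assumes "1 \<le> i" "i \<le> n"
    "\<And>m. Poly_Mapping.lookup a m = (if i \<le> m \<and> m \<le> n then n - m else 0)"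
  shows "groth_rows n i (rev_from n i) = Poly_Mapping.single a 1"
  using assms
proof (induction "n - i" arbitrary: i a)
  case 0
  then have "a = 0" by (intro poly_mapping_eqI) auto
  moreover have "rev_from n i = id" using 0 by (auto simp: rev_from_def fun_eq_iff)
  ultimately show ?case using 0 by (simp add: groth_rows_ge delta_id_def id_def)
next
  case (Suc d)
  then have i: "i < n" "d = n - Suc i" by auto
  define b where "b = a - Poly_Mapping.single i (n - i)"
  have b: "a = Poly_Mapping.single i (n - i) + b"
    using Suc.prems(3) by (intro poly_mapping_eqI) (auto simp: b_def lookup_add lookup_minus lookup_single when_def)
  have "Poly_Mapping.lookup b m = (if Suc i \<le> m \<and> m \<le> n then n - m else 0)" for m
    using Suc.prems(3)[of m] by (auto simp: b_def lookup_minus lookup_single when_def)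
  then have IH: "groth_rows n (Suc i) (rev_from n (Suc i)) = Poly_Mapping.single b 1"
    using Suc.hyps(1)[OF i(2)] i(1) by simp
  \<comment> \<open>\<open>y k\<close> has the value \<open>k\<close> at position \<open>i\<close>,
    followed by the other values of the block in decreasing order. It is the result of the letters
    below \<open>k\<close> in row \<open>i\<close>.\<close>
  define y where "y k m = (if m = i then k else if i < m \<and> m \<le> n then
    (if k < Suc (n + i) - m then Suc (n + i) - m else n + i - m) else m)" for k m
  have yi: "y i = rev_from n (Suc i)" by (auto simp: y_def rev_from_def fun_eq_iff)
  have yn: "y n = rev_from n i" using i by (auto simp: y_def rev_from_def fun_eq_iff)
  have yS: "transpose k (Suc k) \<circ> y (Suc k) = y k" if "i \<le> k" "k < n" for k
    using that by (auto simp: y_def fun_eq_iff Transposition.transpose_def) arith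
  then have yS': "y (Suc k) = transpose k (Suc k) \<circ> y k" if "i \<le> k" "k < n" for k
    using that by (metis comp_assoc id_comp transpose_comp_involutory)
  have "y k permutes {1..n} \<and>
      hecke_row (var i) [i..<k] (groth_rows n (Suc i)) (y k) = Poly_Mapping.single (Poly_Mapping.single i (k - i) + b) 1"
    if "i \<le> k" "k \<le> n" for k
    using that
  proof (induction k rule: dec_induct)
    case base
    then show ?case using rev_from_permutes[of "Suc i" n] by (simp add: yi IH)
  next
    case (step k)
    then have k: "k < n" by simp
    define H where "H = hecke_row (var i) [i..<k] (groth_rows n (Suc i))"
    have pk: "y k permutes {1..n}" using step by simp
    then have pS: "y (Suc k) permutes {1..n}"
      unfolding yS'[OF step.hyps(1) k] using step.hyps Suc.prems(1) k by (intro permutes_transpose_comp) auto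
    have "y (Suc k) i = Suc k" "y (Suc k) (n + i - k) = k"
      using k step.hyps by (auto simp: y_def)
    then have inv: "inv (y (Suc k)) (Suc k) = i" "inv (y (Suc k)) k = n + i - k"
      using pS by (metis permutes_inverses(2))+
    \<comment> \<open>Skipping the letter \<open>k\<close> is impossible: the value
      \<open>Suc k\<close> at \<open>i\<close> is out of reach of smaller letters.\<close>
    have "H (y (Suc k)) = 0"
      using row_groth_rows_support[OF Suc.prems(1) step.hyps(1) _ pS] k unfolding H_def by (force simp: y_def)
    moreover have "i < n + i - k" using k by simp
    ultimately have "hecke_factor k (var i) H (y (Suc k)) = var i * H (y k)"
      using inv permutes_bij[OF pS] by (simp add: hecke_factor_def hecke_left_def yS[OF step.hyps(1) k])
    also have "H (y k) = Poly_Mapping.single (Poly_Mapping.single i (k - i) + b) 1"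
      using step k by (simp add: H_def)
    also have "var i * \<dots> = Poly_Mapping.single (Poly_Mapping.single i (Suc k - i) + b) 1"
      using step.hyps by (simp add: var_def mult_single add.assoc[symmetric] single_add[symmetric] Suc_diff_le)
    finally show ?case using pS by (simp only: row_step[OF step.hyps(1)] H_def)
  qed
  from this[of n] show ?case using i by (simp add: yn b groth_rows_rec[of n i])
qed

lemma groth_rows_longest:
  assumes "1 \<le> n"
  shows "groth_rows n 1 (longest n) = staircase n"
proof -
  have "finite {i. (if 1 \<le> i \<and> i \<le> n then n - i else 0) \<noteq> 0}"
    by (rule finite_subset[of _ "{..n}"]) auto
  moreover have "longest n = rev_from n 1" by (auto simp: longest_def rev_from_def)
  ultimately show ?thesis
    unfolding staircase_def using assms by (simp only:) (rule groth_rows_rev_from, auto)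
qed

text \<open>Gives uniqueness: every chain of ascents in the recursion leads to the same coefficient
  of the product.\<close>

lemma groth_rel_groth_rows:
  assumes "groth_rel n w g" "1 \<le> n"
  shows "w permutes {1..n} \<and> g = groth_rows n 1 w"
  using assms
proof (induction rule: groth_rel.induct)
  case top
  then show ?case using longest_permutes groth_rows_longest by simp
next
  case (step w j g)
  then have u: "w \<circ> transpose j (Suc j) permutes {1..n}" by blast
  have "transpose j (Suc j) permutes {1..n}"
    using step.hyps by (intro permutes_swap_id) auto
  from permutes_compose[OF this u] have w: "w permutes {1..n}"
    by (simp only: comp_assoc transpose_comp_involutory comp_id)
  with step show ?case using bdivdiff_groth_rows permutes_bij by metis
qed

text \<open>The number \<open>w i + i\<close> weakly decreases in \<open>i\<close>, is at most
  \<open>n + 1\<close> at the start and at least \<open>n + 1\<close> at the end.\<close>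

lemma no_ascent_longest:
  assumes w: "w permutes {1..n}" and desc: "\<And>j. 1 \<le> j \<Longrightarrow> j < n \<Longrightarrow> w (Suc j) < w j"
  shows "w = longest n"
proof
  fix i
  show "w i = longest n i"
  proof (cases "i \<in> {1..n}")
    case True
    then have i: "1 \<le> i" "i \<le> n" by auto
    have in_range: "w j \<in> {1..n}" if "1 \<le> j" "j \<le> n" for j
      using permutes_in_image[OF w] that by auto
    have "w i + i \<le> n + 1" using i
    proof (induction i rule: dec_induct)
      case base
      then show ?case using in_range[of 1] by simp
    next
      case (step i)
      then show ?case using desc[of i] by simp
    qed
    moreover have "n + 1 \<le> w i + i" using i(2,1)
    proof (induction i rule: inc_induct)
      case base
      then show ?case using in_range[of n] by simp
    next
      case (step i)
      then show ?case using desc[of i] by simp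
    qed
    ultimately show ?thesis using i by (simp add: longest_def)
  next
    case False
    then show ?thesis using w by (auto simp: longest_def permutes_def)
  qed
qed

lemma groth_rel_exists:
  assumes "w permutes {1..n}"
  shows "\<exists>g. groth_rel n w g"
  using assms
\<comment> \<open>Swapping an ascent lowers this sum, so the recursion terminates.\<close>
proof (induction "\<Sum>i\<in>{1..n}. i * w i" arbitrary: w rule: less_induct)
  case less
  show ?case
  proof (cases "\<exists>j. 1 \<le> j \<and> j < n \<and> w j < w (Suc j)")
    case True
    then obtain j where j: "1 \<le> j" "j < n" "w j < w (Suc j)" by blast
    define u where "u = w \<circ> transpose j (Suc j)"
    define R where "R = {1..n} - {j} - {Suc j}"
    have split: "(\<Sum>i\<in>{1..n}. f i) = f j + (f (Suc j) + (\<Sum>i\<in>R. f i))" for f :: "nat \<Rightarrow> nat"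
      unfolding R_def using j by (simp add: sum.remove[of _ j] sum.remove[of _ "Suc j"])
    have "(\<Sum>i\<in>R. i * u i) = (\<Sum>i\<in>R. i * w i)"
      by (rule sum.cong) (auto simp: R_def u_def)
    then have "(\<Sum>i\<in>{1..n}. i * u i) < (\<Sum>i\<in>{1..n}. i * w i)"
      using j(3) by (simp only: split) (simp add: u_def)
    moreover have "u permutes {1..n}"
      unfolding u_def using j less.prems by (intro permutes_compose[OF permutes_swap_id]) auto
    ultimately obtain g where "groth_rel n u g" using less.hyps by blast
    then show ?thesis using groth_rel.step j unfolding u_def by blast
  next
    case False
    have "w (Suc j) < w j" if "1 \<le> j" "j < n" for j
      using False that permutes_inj[OF less.prems] by (metis injD linorder_neqE_nat n_not_Suc_n)
    then have "w = longest n" using less.prems by (intro no_ascent_longest)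
    then show ?thesis using groth_rel.top by auto
  qed
qed

lemma groth_eq_groth_rows:
  assumes "w permutes {1..n}" "1 \<le> n"
  shows "groth n w = groth_rows n 1 w"
  unfolding groth_def using groth_rel_exists[OF assms(1)] groth_rel_groth_rows[OF _ assms(2)] by (metis the_equality)

section \<open>Weights and top components\<close>

lemma lookup_wt:
  "Poly_Mapping.lookup (wt n D) m = (if 1 \<le> m \<and> m \<le> n then card {j. (m, j) \<in> D} else 0)"
proof -
  have "finite {i. (if 1 \<le> i \<and> i \<le> n then card {j. (i, j) \<in> D} else 0) \<noteq> 0}"
    by (rule finite_subset[of _ "{..n}"]) auto
  then show ?thesis by (simp add: wt_def)
qed

text \<open>A box in column \<open>j\<close> at or below row \<open>m\<close> says that the value
  \<open>j\<close> has a larger value before it at some position from \<open>m\<close> on. So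
  \<open>w\<close> maps the exceeded positions bijectively to the columns of the row.\<close>

lemma lookup_wt_rothe:
  assumes "w permutes {1..n}"
  shows "Poly_Mapping.lookup (wt n (upper_closure n (rothe n w))) m = (if 1 \<le> m then card (exceeded n w m) else 0)"
proof (cases "1 \<le> m \<and> m \<le> n")
  case True
  have iw: "inv w x = y \<longleftrightarrow> w y = x" for x y using assms by (metis permutes_inverses)
  have rng: "w x \<in> {1..n} \<longleftrightarrow> x \<in> {1..n}" for x using permutes_in_image[OF assms] .
  have "{j. (m, j) \<in> upper_closure n (rothe n w)} = w ` exceeded n w m"
  proof (intro set_eqI iffI)
    fix j assume "j \<in> {j. (m, j) \<in> upper_closure n (rothe n w)}"
    then obtain i where i: "m \<le> i" "i \<in> {1..n}" "j \<in> {1..n}" "i < inv w j" "j < w i"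
      by (auto simp: upper_closure_def rothe_def)
    moreover have "w (inv w j) = j" using iw by blast
    moreover from this have "inv w j \<in> {1..n}" using rng[of "inv w j"] i(3) by simp
    ultimately show "j \<in> w ` exceeded n w m"
      by (intro image_eqI[of _ _ "inv w j"]) (auto simp: exceeded_def intro!: bexI[of _ i])
  next
    fix j assume "j \<in> w ` exceeded n w m"
    then obtain p q where p: "j = w p" "m < p" "p \<le> n" "m \<le> q" "q < p" "w p < w q"
      by (auto simp: exceeded_def)
    then have "inv w j = p" "j \<in> {1..n}" using iw rng[of p] True by auto
    then show "j \<in> {j. (m, j) \<in> upper_closure n (rothe n w)}"
      using p True by (auto simp: upper_closure_def rothe_def intro!: exI[of _ q])
  qed
  moreover have "card (w ` exceeded n w m) = card (exceeded n w m)"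
    using permutes_inj[OF assms] by (intro card_image) (auto intro: inj_on_subset)
  ultimately show ?thesis using True by (simp add: lookup_wt)
next
  case False
  then have "1 \<le> m \<Longrightarrow> exceeded n w m = {}" by (auto simp: exceeded_def)
  with False show ?thesis by (auto simp: lookup_wt)
qed

lemma keys_top_part:
  "Poly_Mapping.keys (top_part f) = {a \<in> Poly_Mapping.keys f. tdeg a = Max (tdeg ` Poly_Mapping.keys f)}"
proof -
  have "finite {a. (if tdeg a = Max (tdeg ` Poly_Mapping.keys f) then Poly_Mapping.lookup f a else 0) \<noteq> 0}"
    by (rule finite_subset[of _ "Poly_Mapping.keys f"]) (auto simp: in_keys_iff)
  then show ?thesis by (auto simp: top_part_def in_keys_iff split: if_splits)
qed

lemma tdeg_eq_0: "tdeg c = 0 \<longleftrightarrow> c = 0"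
  by (auto simp: tdeg_def in_keys_iff intro!: poly_mapping_eqI)

text \<open>An exponent vector that is componentwise below \<open>b\<close> and different from it
  has smaller total degree.\<close>

lemma keys_top_part_singleton:
  assumes "b \<in> Poly_Mapping.keys f"
    and le: "\<And>a m. a \<in> Poly_Mapping.keys f \<Longrightarrow> Poly_Mapping.lookup a m \<le> Poly_Mapping.lookup b m"
  shows "Poly_Mapping.keys (top_part f) = {b}"
proof -
  have add: "b = a + (b - a)" if "a \<in> Poly_Mapping.keys f" for a
    using le[OF that] by (intro poly_mapping_eqI) (simp add: lookup_add lookup_minus)
  have "tdeg a \<le> tdeg b" if "a \<in> Poly_Mapping.keys f" for a
    using tdeg_add[of a "b - a"] add[OF that] by simp
  then have "Max (tdeg ` Poly_Mapping.keys f) = tdeg b"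
    using assms(1) by (intro Max_eqI) auto
  moreover have "a = b" if "a \<in> Poly_Mapping.keys f" "tdeg a = tdeg b" for a
  proof -
    have "tdeg (b - a) = 0" using tdeg_add[of a "b - a"] add[OF that(1)] that(2) by simp
    then show ?thesis using add[OF that(1)] by (simp add: tdeg_eq_0)
  qed
  ultimately show ?thesis using assms(1) by (auto simp: keys_top_part)
qed

section \<open>Fireworks permutations\<close>

text \<open>The fireworks condition from position \<open>i\<close> on: ascent tops are left-to-right
  maxima. In this form it passes to the permutations left after a row is removed.\<close>

definition records_from :: "nat \<Rightarrow> nat \<Rightarrow> (nat \<Rightarrow> nat) \<Rightarrow> bool" where
  "records_from n i w \<longleftrightarrow>
    (\<forall>p q. i < p \<and> p \<le> n \<and> w (p - 1) < w p \<and> i \<le> q \<and> q < p \<longrightarrow> w q < w p)"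

lemma fireworks_records_from:
  assumes "w permutes {1..n}" "fireworks n w"
  shows "records_from n 1 w"
  unfolding records_from_def
proof safe
  fix p q assume p: "1 < p" "p \<le> n" "w (p - 1) < w p" and q: "1 \<le> q" "q < p"
  \<comment> \<open>Every value is at most the initial element of its decreasing run.\<close>
  have "\<exists>r\<le>q. run_start w n r \<and> w q \<le> w r" if "1 \<le> q" "q \<le> n" for q
    using that
  proof (induction q rule: dec_induct)
    case base
    then show ?case by (auto simp: run_start_def)
  next
    case (step q)
    show ?case
    proof (cases "w q < w (Suc q)")
      case True
      then show ?thesis using step by (intro exI[of _ "Suc q"]) (auto simp: run_start_def)
    next
      case False
      then show ?thesis using step by (meson Suc_leD le_SucI le_trans not_le)
    qed
  qed
  then obtain r where r: "r \<le> q" "run_start w n r" "w q \<le> w r" using p q by (meson less_imp_le_nat le_trans)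
  have "run_start w n p" using p by (simp add: run_start_def)
  then have "w r < w p" using assms(2) r q unfolding fireworks_def by (meson le_less_trans)
  then show "w q < w p" using r by simp
qed

text \<open>The expansion has nonnegative terms, so any one of them is a lower bound; here the one
  that skips the letter \<open>k\<close>.\<close>

lemma signed_coeff_factor_ge:
  assumes "\<And>w a. w permutes {1..n} \<Longrightarrow> 0 \<le> signed_coeff w (F w) a" "1 \<le> k" "k < n" "w permutes {1..n}"
  shows "signed_coeff w (F w) a \<le> signed_coeff w (hecke_factor k (var i) F w) a"
proof (cases a i rule: expvec_cases)
  case 1
  then show ?thesis by (simp add: signed_coeff_factor_0)
next
  case (2 b)
  show ?thesis
  proof (cases "inv w (Suc k) < inv w k")
    case True
    then show ?thesis
      unfolding 2 signed_coeff_factor_desc[OF assms(4) True]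
      using assms(1)[OF permutes_transpose_comp[OF assms(4,2,3)], of b] assms(1)[OF assms(4), of b] by simp
  next
    case False
    then show ?thesis by (simp add: hecke_factor_def hecke_left_def)
  qed
qed

text \<open>Here a term using the letter is kept; \<open>v = w\<close> is the one from the square
  relation.\<close>

lemma signed_coeff_factor_desc_ge:
  assumes "\<And>w a. w permutes {1..n} \<Longrightarrow> 0 \<le> signed_coeff w (F w) a" "1 \<le> k" "k < n" "w permutes {1..n}"
    "inv w (Suc k) < inv w k" "v = w \<or> v = transpose k (Suc k) \<circ> w"
  shows "signed_coeff v (F v) b \<le> signed_coeff w (hecke_factor k (var i) F w) (Poly_Mapping.single i 1 + b)"
  unfolding signed_coeff_factor_desc[OF assms(4,5)]
  using assms(1)[OF permutes_transpose_comp[OF assms(4,2,3)], of b] assms(1)[OF assms(4), of b]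
    assms(1)[OF assms(4), of "Poly_Mapping.single i 1 + b"] assms(6) by auto

definition descent_bottoms :: "nat \<Rightarrow> nat \<Rightarrow> (nat \<Rightarrow> nat) \<Rightarrow> nat set" where
  "descent_bottoms n i w = {p. i < p \<and> p \<le> n \<and> w p < w (p - 1)}"

lemma finite_descent_bottoms [simp]: "finite (descent_bottoms n i w)"
  by (rule finite_subset[of _ "{..n}"]) (auto simp: descent_bottoms_def)

text \<open>Invariant of undoing the letters \<open>n - 1, \<dots>, k\<close> of row \<open>i\<close>, which turns \<open>w\<close> into \<open>y\<close>.  The letters are
  the values of \<open>w\<close> at descent bottoms.  Undoing \<open>k\<close> either keeps \<open>y\<close>, by \<open>u\<^sub>k\<^sup>2 = - u\<^sub>k\<close>, or swaps the
  values \<open>k\<close> and \<open>k + 1\<close>; it swaps unless they are neighbours to the right of position \<open>i\<close>, where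
  a swap would destroy a descent.  The fifth clause guarantees that \<open>k + 1\<close> stands to the left
  of \<open>k\<close> when \<open>k\<close> is undone.\<close>

definition peeled :: "nat \<Rightarrow> nat \<Rightarrow> (nat \<Rightarrow> nat) \<Rightarrow> nat \<Rightarrow> (nat \<Rightarrow> nat) \<Rightarrow> bool" where
  "peeled n i w k y \<longleftrightarrow> y permutes {1..n} \<and> (\<forall>m<i. y m = m) \<and> y i = min (w i) k
    \<and> (\<forall>p. y p < k \<or> w p < k \<longrightarrow> y p = w p)
    \<and> (\<forall>r p q. y r = k \<and> w p < k \<and> i \<le> q \<and> q < p \<and> k \<le> w q \<longrightarrow> r < p)
    \<and> (\<forall>p. Suc i < p \<and> p \<le> n \<longrightarrow> (y p < y (p - 1) \<longleftrightarrow> w p < w (p - 1)))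
    \<and> (\<forall>p q. Suc i < p \<and> p \<le> n \<and> y (p - 1) < y p \<and> i < q \<and> q < p \<longrightarrow> y q < y p)"

section \<open>Undoing the letters of one row\<close>

lemma peeledD:
  assumes "peeled n i w k y"
  shows "y permutes {1..n}" "\<forall>m<i. y m = m" "y i = min (w i) k"
    "\<forall>p. y p < k \<or> w p < k \<longrightarrow> y p = w p"
    "\<forall>r p q. y r = k \<and> w p < k \<and> i \<le> q \<and> q < p \<and> k \<le> w q \<longrightarrow> r < p"
    "\<forall>p. Suc i < p \<and> p \<le> n \<longrightarrow> (y p < y (p - 1) \<longleftrightarrow> w p < w (p - 1))"
    "\<forall>p q. Suc i < p \<and> p \<le> n \<and> y (p - 1) < y p \<and> i < q \<and> q < p \<longrightarrow> y q < y p"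
  using assms unfolding peeled_def by blast+

lemma peeled_start:
  assumes "w permutes {1..n}" "\<forall>m<i. w m = m" "records_from n i w" "1 \<le> i" "i \<le> n"
  shows "peeled n i w n w"
proof -
  \<comment> \<open>Inside the block only the position of \<open>n\<close> has a value at least
    \<open>n\<close>, hence \<open>q = r\<close>.\<close>
  have J: "\<forall>r p q. w r = n \<and> w p < n \<and> i \<le> q \<and> q < p \<and> n \<le> w q \<longrightarrow> r < p"
  proof (intro allI impI, elim conjE)
    fix r p q assume *: "w r = n" "w p < n" "i \<le> q" "q < p" "n \<le> w q"
    have "p \<le> n"
    proof (rule ccontr)
      assume "\<not> p \<le> n"
      then have "w p = p" using assms(1) by (simp add: permutes_def)
      then show False using *(2) \<open>\<not> p \<le> n\<close> by simp
    qed
    then have "q \<in> {1..n}" using * assms(4) by simp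
    then have "w q \<le> n" using permutes_in_image[OF assms(1), of q] by simp
    then have "w q = w r" using * by simp
    then have "q = r" using permutes_inj[OF assms(1)] by (simp add: inj_eq)
    then show "r < p" using * by simp
  qed
  have "w i \<le> n" using permutes_in_image[OF assms(1), of i] assms(4,5) by simp
  then have "w i = min (w i) n" by simp
  moreover have "\<forall>p q. Suc i < p \<and> p \<le> n \<and> w (p - 1) < w p \<and> i < q \<and> q < p \<longrightarrow> w q < w p"
    using assms(3) unfolding records_from_def by (meson Suc_lessD order.strict_implies_order)
  moreover have "\<forall>p. w p < n \<or> w p < n \<longrightarrow> w p = w p" by simp
  moreover have "\<forall>p. Suc i < p \<and> p \<le> n \<longrightarrow> (w p < w (p - 1) \<longleftrightarrow> w p < w (p - 1))" by simp
  ultimately show ?thesis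
    using assms(1,2) J unfolding peeled_def by (intro conjI) (assumption+)
qed

text \<open>The value \<open>k\<close> stands at position \<open>i\<close> or tops an ascent, so it
  is a record and all values before it from \<open>i\<close> on are smaller. This yields the changed
  clauses with the same \<open>y\<close>.\<close>

lemma peeled_keep_nonbottom:
  assumes w: "w permutes {1..n}" "records_from n i w" and fixed: "\<forall>m<i. w m = m"
    and k: "1 \<le> i" "i \<le> k" "k < n"
    and nb: "k \<notin> w ` descent_bottoms n i w"
    and y: "peeled n i w (Suc k) y"
  shows "peeled n i w k y"
proof -
  have injw: "w a = w b \<longleftrightarrow> a = b" for a b using permutes_inj[OF w(1)] by (simp add: inj_eq)
  obtain P where P: "w P = k" using w(1) by (metis permutes_inverses(1))
  have Pn: "P \<le> n" "i \<le> P"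
    using permutes_in_image[OF w(1), of P] P k fixed by (auto simp: not_less[symmetric])
  have rec: "w q < k" if "i \<le> q" "q < P" for q
  proof -
    have "\<not> w P < w (P - 1)" using nb P Pn that by (auto simp: descent_bottoms_def)
    moreover have "w P \<noteq> w (P - 1)" using that injw by simp
    ultimately have "w (P - 1) < w P" by simp
    then show ?thesis using w(2) that P Pn unfolding records_from_def by (metis le_less_trans)
  qed
  have yP: "y r = k \<Longrightarrow> r = P" for r using peeledD(4)[OF y] injw P by (metis lessI)
  have "y i = min (w i) k"
  proof -
    have "w i \<le> k" using rec[of i] P Pn by (cases "i = P") auto
    then show ?thesis using peeledD(3)[OF y] by simp
  qed
  moreover have U: "\<forall>p. y p < k \<or> w p < k \<longrightarrow> y p = w p"
    using peeledD(4)[OF y] less_SucI by metis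
  moreover have "\<forall>r p q. y r = k \<and> w p < k \<and> i \<le> q \<and> q < p \<and> k \<le> w q \<longrightarrow> r < p"
  proof (intro allI impI, elim conjE, rule ccontr)
    fix r p q assume *: "y r = k" "w p < k" "i \<le> q" "q < p" "k \<le> w q" "\<not> r < p"
    then have "q < P" using yP[of r] by simp
    then show False using rec[of q] * by simp
  qed
  ultimately show ?thesis using peeledD[OF y] unfolding peeled_def by (intro conjI) (assumption+)
qed

lemma peeled_step_bottom:
  assumes w: "w permutes {1..n}" and k: "1 \<le> i" "i \<le> k" "k < n"
    and nb: "k \<in> w ` descent_bottoms n i w"
    and y: "peeled n i w (Suc k) y"
  shows "inv y (Suc k) < inv y k \<and> (peeled n i w k y \<or> peeled n i w k (transpose k (Suc k) \<circ> y))"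
proof -
  have injw: "w a = w b \<longleftrightarrow> a = b" for a b using permutes_inj[OF w] by (simp add: inj_eq)
  have py: "y permutes {1..n}" using y by (rule peeledD)
  have injy: "y a = y b \<longleftrightarrow> a = b" for a b using permutes_inj[OF py] by (simp add: inj_eq)
  obtain P where P: "w P = k" "i < P" "P \<le> n" "k < w (P - 1)" using nb by (auto simp: descent_bottoms_def)
  obtain r where r: "y r = Suc k" using py by (metis permutes_inverses(1))
  have front: "y i = min (w i) (Suc k)"
    and untouched: "\<And>p. y p < Suc k \<or> w p < Suc k \<Longrightarrow> y p = w p"
    and J: "\<And>p q. w p < Suc k \<Longrightarrow> i \<le> q \<Longrightarrow> q < p \<Longrightarrow> Suc k \<le> w q \<Longrightarrow> r < p"
    and D: "\<And>p. Suc i < p \<Longrightarrow> p \<le> n \<Longrightarrow> y p < y (p - 1) \<longleftrightarrow> w p < w (p - 1)"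
    and F: "\<And>p q. Suc i < p \<Longrightarrow> p \<le> n \<Longrightarrow> y (p - 1) < y p \<Longrightarrow> i < q \<Longrightarrow> q < p \<Longrightarrow> y q < y p"
    using peeledD(3-7)[OF y] r by blast+
  have yP: "y P = k" using untouched[of P] P by simp
  \<comment> \<open>The descent at \<open>P\<close> makes \<open>P - 1\<close> a witness for the
    fifth clause, which puts \<open>Suc k\<close> to the left of \<open>k\<close>.\<close>
  have rP: "r < P" using J[of P "P - 1"] P by simp
  have before: "r < p" if "w p < k" "i \<le> q" "q < p" "k \<le> w q" for p q
  proof (cases "w q = k")
    case True
    then have "q = P" using injw P(1) by metis
    then show ?thesis using J[of p "P - 1"] that P by simp
  qed (use J[of p q] that in simp)
  have inv: "inv y (Suc k) = r" "inv y k = P" using py r yP by (metis permutes_inverses(2))+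
  have wi: "w i \<noteq> k" using injw[of i P] P by simp
  show ?thesis
  proof (cases "P = Suc r \<and> i < r")
    case True
    have "y i = min (w i) k"
    proof -
      have "y i \<noteq> Suc k" using injy[of i r] r True by simp
      then show ?thesis using front wi by auto
    qed
    moreover have U: "\<forall>p. y p < k \<or> w p < k \<longrightarrow> y p = w p"
      using untouched less_SucI by metis
    moreover have "\<forall>r p q. y r = k \<and> w p < k \<and> i \<le> q \<and> q < p \<and> k \<le> w q \<longrightarrow> r < p"
    proof (intro allI impI, elim conjE)
      fix r' p q assume *: "y r' = k" "w p < k" "i \<le> q" "q < p" "k \<le> w q"
      have "r' = P" using injy *(1) yP by metis
      moreover have "p \<noteq> P" using *(2) P by auto
      \<comment> \<open>As \<open>P = Suc r\<close>, the facts \<open>r < p\<close> and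
        \<open>p \<noteq> P\<close> give \<open>P < p\<close>.\<close>
      ultimately show "r' < p" using before[OF *(2-5)] True by simp
    qed
    ultimately have "peeled n i w k y"
      using peeledD[OF y] unfolding peeled_def by (intro conjI) (assumption+)
    then show ?thesis using inv rP by simp
  next
    case False
    define z where "z = transpose k (Suc k) \<circ> y"
    \<comment> \<open>The swap reverses only the pair of positions \<open>r\<close>,
      \<open>P\<close>, which here are not neighbours beyond \<open>i\<close>.\<close>
    have zlt: "z a < z b \<longleftrightarrow> y a < y b" if "a \<noteq> b" "{a, b} \<noteq> {r, P}" for a b
      unfolding z_def comp_apply
    proof (rule transpose_Suc_less_iff)
      show "y a \<noteq> y b" using injy that by simp
      show "{y a, y b} \<noteq> {k, Suc k}"
        using injy[of a P] injy[of b P] injy[of a r] injy[of b r] that(2) r yP by (auto simp: doubleton_eq_iff)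
    qed
    have zy: "z p = y p" if "y p \<noteq> k" "y p \<noteq> Suc k" for p using that by (simp add: z_def)
    have "z permutes {1..n}" unfolding z_def using py k by (intro permutes_transpose_comp) auto
    moreover have "\<forall>m<i. z m = m"
    proof (intro allI impI)
      fix m assume "m < i"
      then have "y m = m" using peeledD(2)[OF y] by simp
      then show "z m = m" using zy[of m] \<open>m < i\<close> k by simp
    qed
    \<comment> \<open>If \<open>w i > k\<close>, then \<open>y i = Suc k\<close> and the swap lowers
      it to \<open>k\<close>; if \<open>w i < k\<close>, nothing changes at
      \<open>i\<close>.\<close>
    moreover have "z i = min (w i) k"
      using front wi zy[of i] by (cases "w i < k") (auto simp: z_def)
    moreover have "\<forall>p. z p < k \<or> w p < k \<longrightarrow> z p = w p"
    proof (intro allI impI)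
      fix p assume *: "z p < k \<or> w p < k"
      have "y p < k"
      proof (cases "w p < k")
        case False
        then have "z p < k" using * by simp
        then show ?thesis by (auto simp: z_def Transposition.transpose_def split: if_splits)
      qed (use untouched[of p] in simp)
      then show "z p = w p" using untouched[of p] zy[of p] by simp
    qed
    moreover have "\<forall>r' p q. z r' = k \<and> w p < k \<and> i \<le> q \<and> q < p \<and> k \<le> w q \<longrightarrow> r' < p"
    proof (intro allI impI, elim conjE)
      fix r' p q assume *: "z r' = k" "w p < k" "i \<le> q" "q < p" "k \<le> w q"
      have "y r' = Suc k" using *(1) by (auto simp: z_def Transposition.transpose_def split: if_splits)
      then have "r' = r" using injy r by metis
      then show "r' < p" using before[OF *(2-5)] by simp
    qed
    moreover have Dz: "\<forall>p. Suc i < p \<and> p \<le> n \<longrightarrow> (z p < z (p - 1) \<longleftrightarrow> w p < w (p - 1))"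
    proof (intro allI impI, elim conjE)
      fix p assume *: "Suc i < p" "p \<le> n"
      have "{p, p - 1} \<noteq> {r, P}" using False rP * by (auto simp: doubleton_eq_iff)
      moreover have "p \<noteq> p - 1" using * by simp
      ultimately show "z p < z (p - 1) \<longleftrightarrow> w p < w (p - 1)" using zlt[of p "p - 1"] D[OF *] by blast
    qed
    moreover have "\<forall>p q. Suc i < p \<and> p \<le> n \<and> z (p - 1) < z p \<and> i < q \<and> q < p \<longrightarrow> z q < z p"
    proof (intro allI impI, elim conjE)
      fix p q assume *: "Suc i < p" "p \<le> n" "z (p - 1) < z p" "i < q" "q < p"
      have nd: "\<not> w p < w (p - 1)" using Dz *(1-3) order.asym by blast
      moreover have "y p \<noteq> y (p - 1)" using injy[of p "p - 1"] * by simp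
      ultimately have asc: "y (p - 1) < y p" using D[OF *(1,2)] by simp
      \<comment> \<open>\<open>P\<close> is a descent bottom and \<open>p\<close> an ascent top; as
        \<open>r < P\<close> and \<open>q < p\<close>, the pair \<open>q\<close>, \<open>p\<close>
        is not the swapped one.\<close>
      have "p \<noteq> P" using P(1,4) nd by metis
      then have "{q, p} \<noteq> {r, P}" using rP *(5) by (auto simp: doubleton_eq_iff)
      moreover have "q \<noteq> p" using *(5) by simp
      ultimately show "z q < z p" using zlt[of q p] F[OF *(1,2) asc *(4,5)] by blast
    qed
    ultimately have "peeled n i w k z" unfolding peeled_def by (intro conjI) (assumption+)
    then show ?thesis using inv rP by (simp add: z_def)
  qed
qed

text \<open>Downward induction on the letters, following one choice: use \<open>k\<close> exactly
  when it is the value of a descent bottom. Each use adds one to the exponent of x_i, and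
  nonnegativity allows discarding all other choices.\<close>

lemma peel:
  assumes w: "w permutes {1..n}" "records_from n i w" and fixed: "\<forall>m<i. w m = m"
    and i: "1 \<le> i" "i \<le> n"
    and F: "\<And>w a. w permutes {1..n} \<Longrightarrow> 0 \<le> signed_coeff w (F w) a"
    and k: "i \<le> k" "k \<le> n"
  shows "\<exists>y. peeled n i w k y \<and>
    (\<forall>b. signed_coeff y (hecke_row (var i) [i..<k] F y) b \<le> signed_coeff w (hecke_row (var i) [i..<n] F w)
      (Poly_Mapping.single i (card (w ` descent_bottoms n i w \<inter> {k..<n})) + b))"
  using k(2,1)
proof (induction k rule: inc_induct)
  case base
  then show ?case using peeled_start[OF w(1) fixed w(2) i] by (intro exI[of _ w]) simp
next
  case (step k)
  define N where "N = w ` descent_bottoms n i w"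
  define H where "H k = hecke_row (var i) [i..<k] F" for k
  obtain y where y: "peeled n i w (Suc k) y" and
    le: "\<And>b. signed_coeff y (H (Suc k) y) b \<le> signed_coeff w (H n w) (Poly_Mapping.single i (card (N \<inter> {Suc k..<n})) + b)"
    using step unfolding N_def H_def by auto
  have py: "y permutes {1..n}" using y by (rule peeledD)
  have pos: "0 \<le> signed_coeff v (H k v) a" if "v permutes {1..n}" for v a
    unfolding H_def using F i(1) step that by (intro signed_coeff_row_nonneg) auto
  have k: "1 \<le> k" "k < n" using i step by auto
  have HS: "H (Suc k) = hecke_factor k (var i) (H k)" using row_step[OF step.prems] by (simp only: H_def)
  have Nk: "N \<inter> {k..<n} = (if k \<in> N then insert k (N \<inter> {Suc k..<n}) else N \<inter> {Suc k..<n})"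
    using k by (auto simp: Suc_le_eq le_less)
  show ?case
  proof (cases "k \<in> N")
    case False
    then have "peeled n i w k y"
      using peeled_keep_nonbottom[OF w fixed i(1) step.prems k(2) _ y] by (simp add: N_def)
    moreover have "signed_coeff y (H k y) b \<le> signed_coeff w (H n w) (Poly_Mapping.single i (card (N \<inter> {k..<n})) + b)" for b
      using signed_coeff_factor_ge[where F = "H k" and i = i, OF pos k py, of b] le[of b] False by (simp add: HS Nk)
    ultimately show ?thesis unfolding N_def H_def by blast
  next
    case True
    then obtain z where z: "peeled n i w k z" "z = y \<or> z = transpose k (Suc k) \<circ> y"
      and desc: "inv y (Suc k) < inv y k"
      using peeled_step_bottom[OF w(1) i(1) step.prems k(2) _ y] unfolding N_def by blast
    have "signed_coeff z (H k z) b \<le> signed_coeff w (H n w) (Poly_Mapping.single i (card (N \<inter> {k..<n})) + b)" for b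
    proof -
      have "signed_coeff z (H k z) b \<le> signed_coeff y (H (Suc k) y) (Poly_Mapping.single i 1 + b)"
        unfolding HS by (rule signed_coeff_factor_desc_ge[where F = "H k", OF pos k py desc z(2)])
      also have "\<dots> \<le> signed_coeff w (H n w) (Poly_Mapping.single i (card (N \<inter> {Suc k..<n})) + (Poly_Mapping.single i 1 + b))"
        by (rule le)
      also have "Poly_Mapping.single i (card (N \<inter> {Suc k..<n})) + (Poly_Mapping.single i 1 + b) =
          Poly_Mapping.single i (card (N \<inter> {k..<n})) + b"
        using True by (simp add: Nk add.assoc[symmetric] single_add[symmetric])
      finally show ?thesis .
    qed
    with z(1) show ?thesis unfolding N_def H_def by blast
  qed
qed

text \<open>Undoing all of row \<open>i\<close> leaves a permutation that fixes \<open>i\<close>,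
  has the same descents beyond \<open>i\<close> and satisfies the record condition from
  \<open>Suc i\<close> on, so the induction continues with the next row.\<close>

lemma signed_coeff_groth_rows_pos:
  assumes "w permutes {1..n}" "records_from n i w" "\<forall>m<i. w m = m" "1 \<le> i"
    "\<And>m. Poly_Mapping.lookup a m = (if i \<le> m then card (descent_bottoms n m w) else 0)"
  shows "0 < signed_coeff w (groth_rows n i w) a"
  using assms
proof (induction "n - i" arbitrary: i w a)
  case 0
  have "w m = m" for m
  proof (cases "m < i \<or> n < m")
    case True
    then show ?thesis using 0 by (auto simp: permutes_def)
  next
    case False
    then have m: "m = n" "i = n" using 0 by auto
    then have "w n \<le> n" using permutes_in_image[OF 0(2), of n] 0(5) by simp
    moreover have "w (w n) = w n" if "w n < n" using 0(4) m that by simp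
    then have "w n = n" if "w n < n" using permutes_inj[OF 0(2)] that by (simp add: inj_eq)
    ultimately show ?thesis using m by fastforce
  qed
  then have "w = id" by auto
  moreover have "descent_bottoms n m w = {}" for m
    using \<open>w = id\<close> by (auto simp: descent_bottoms_def)
  then have "a = 0" using 0 by (intro poly_mapping_eqI) simp
  ultimately show ?case using 0 by (simp add: signed_coeff_def groth_rows_ge delta_id_def id_def tdeg_eq_0[THEN iffD2])
next
  case (Suc d)
  then have i: "i < n" "d = n - Suc i" by auto
  have w: "w permutes {1..n}" by (rule Suc.prems(1))
  obtain y where y: "peeled n i w i y" and
    le: "\<And>b. signed_coeff y (groth_rows n (Suc i) y) b \<le> signed_coeff w (groth_rows n i w)
      (Poly_Mapping.single i (card (w ` descent_bottoms n i w \<inter> {i..<n})) + b)"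
    using peel[OF w Suc.prems(2,3,4) _ signed_coeff_groth_rows_nonneg[of _ n "Suc i"], of i] i
    by (auto simp: groth_rows_rec[of n i])
  \<comment> \<open>All descent bottoms have values among the letters of row \<open>i\<close>, so
    each of them contributes to the exponent.\<close>
  have "w p \<in> {i..<n}" if "p \<in> descent_bottoms n i w" for p
  proof -
    have p: "i < p" "p \<le> n" "w p < w (p - 1)" using that by (auto simp: descent_bottoms_def)
    have "w (p - 1) \<le> n" using permutes_in_image[OF w, of "p - 1"] p Suc.prems(4) by auto
    moreover have "i \<le> w p"
    proof (rule ccontr)
      assume "\<not> i \<le> w p"
      then have "w (w p) = w p" using Suc.prems(3) by simp
      then have "w p = p" using permutes_inj[OF w] by (simp add: inj_eq)
      then show False using p \<open>\<not> i \<le> w p\<close> by simp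
    qed
    ultimately show ?thesis using p by simp
  qed
  then have "w ` descent_bottoms n i w \<inter> {i..<n} = w ` descent_bottoms n i w" by blast
  then have card: "card (w ` descent_bottoms n i w \<inter> {i..<n}) = card (descent_bottoms n i w)"
    using permutes_inj[OF w] by (metis card_image inj_on_subset subset_UNIV)
  define b where "b = a - Poly_Mapping.single i (card (descent_bottoms n i w))"
  have a: "a = Poly_Mapping.single i (card (descent_bottoms n i w)) + b"
    using Suc.prems(5) by (intro poly_mapping_eqI) (auto simp: b_def lookup_add lookup_minus lookup_single when_def)
  have injw: "w p = w q \<longleftrightarrow> p = q" for p q using permutes_inj[OF w] by (simp add: inj_eq)
  have yi: "y i = i" if "i \<le> w i" using peeledD(3)[OF y] that by simp
  have "i \<le> w i"
  proof (rule ccontr)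
    assume "\<not> i \<le> w i"
    then have "w (w i) = w i" using Suc.prems(3) by simp
    then show False using injw \<open>\<not> i \<le> w i\<close> by simp
  qed
  note yi = yi[OF this]
  have D: "y p < y (p - 1) \<longleftrightarrow> w p < w (p - 1)" if "Suc i < p" "p \<le> n" for p
    using peeledD(6)[OF y] that by blast
  have "0 < signed_coeff y (groth_rows n (Suc i) y) b"
  proof (rule Suc.hyps(1)[OF i(2)])
    show "y permutes {1..n}" using y by (rule peeledD)
    show "records_from n (Suc i) y" using peeledD(7)[OF y] by (auto simp: records_from_def Suc_le_eq)
    show "\<forall>m<Suc i. y m = m" using peeledD(2)[OF y] yi by (simp add: less_Suc_eq)
    show "1 \<le> Suc i" by simp
    fix m
    \<comment> \<open>These bottoms lie beyond \<open>Suc i\<close>, where the invariant preserves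
      descents.\<close>
    have "descent_bottoms n m y = descent_bottoms n m w" if "i < m"
      using D that by (auto simp: descent_bottoms_def)
    then show "Poly_Mapping.lookup b m = (if Suc i \<le> m then card (descent_bottoms n m y) else 0)"
      using Suc.prems(5)[of m] by (auto simp: b_def lookup_minus lookup_single when_def)
  qed
  then show ?case using le[of b] card a by simp
qed

text \<open>A position beyond \<open>m\<close> that is no descent bottom tops an ascent, hence is a
  record and not exceeded; a descent bottom is exceeded by its left neighbour.\<close>

lemma exceeded_eq_descent_bottoms:
  assumes "w permutes {1..n}" "records_from n i w" "i \<le> m"
  shows "exceeded n w m = descent_bottoms n m w"
proof (intro set_eqI iffI)
  fix p assume "p \<in> exceeded n w m"
  then obtain q where p: "m < p" "p \<le> n" "m \<le> q" "q < p" "w p < w q" by (auto simp: exceeded_def)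
  then have "\<not> w (p - 1) < w p"
    using assms(2,3) unfolding records_from_def by (metis le_less_trans le_trans not_less_iff_gr_or_eq)
  moreover have "w (p - 1) \<noteq> w p" using permutes_inj[OF assms(1)] p by (auto simp: inj_eq)
  ultimately show "p \<in> descent_bottoms n m w" using p by (simp add: descent_bottoms_def)
next
  fix p assume "p \<in> descent_bottoms n m w"
  then show "p \<in> exceeded n w m"
    by (auto simp: descent_bottoms_def exceeded_def intro!: bexI[of _ "p - 1"])
qed

theorem theorem3p14:
  fixes n :: nat and w :: "nat \<Rightarrow> nat"
  assumes "n \<ge> 1" and "w permutes {1..n}" and "fireworks n w"
  shows "Poly_Mapping.keys (top_part (groth n w)) = {wt n (upper_closure n (rothe n w))}"
proof (rule keys_top_part_singleton)
  let ?b = "wt n (upper_closure n (rothe n w))"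
  have rec: "records_from n 1 w" by (rule fireworks_records_from) fact+
  have groth: "groth n w = groth_rows n 1 w" using assms by (intro groth_eq_groth_rows)
  have b: "Poly_Mapping.lookup ?b m = (if 1 \<le> m then card (exceeded n w m) else 0)" for m
    using assms by (intro lookup_wt_rothe)
  have "w 0 = 0" using assms(2) by (auto simp: permutes_def)
  \<comment> \<open>By the record condition the weight counts descent bottoms;
    \<open>w 0 = 0\<close> is the fixed-point condition below 1.\<close>
  then have "0 < signed_coeff w (groth_rows n 1 w) ?b"
    using rec assms by (intro signed_coeff_groth_rows_pos) (auto simp: b exceeded_eq_descent_bottoms)
  then show "?b \<in> Poly_Mapping.keys (groth n w)"
    by (auto simp: groth signed_coeff_def in_keys_iff)
  fix a m assume "a \<in> Poly_Mapping.keys (groth n w)"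
  then show "Poly_Mapping.lookup a m \<le> Poly_Mapping.lookup ?b m"
    using keys_groth_rows[OF assms(2), of a 1] by (cases m) (auto simp: groth b)
qed

end
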